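(* There exists a constant $C$ such that, for every positive integer $k$ and every $n$-vertex graph $H$, \[ R_{\mathrm{ind}}(H;k) \leq \big(C n^2 k R(n;k)\big)^{7n} \leq \exp\left(C k n^2 \log k\right). \]
   Context: For graphs $G$ and $H$ and a positive integer $k$, write $G \rightarrow (H)_k$ if for every colouring $c \colon E(G) \to \{1,\dotsc,k\}$ there is an $i \in \{1,\dotsc,k\}$ such that the graph $c^{-1}(i)$ contains $H$ as a subgraph. $R(n;k)$ is the smallest integer $N$ such that $K_N \rightarrow (K_n)_k$ (the $k$-colour Ramsey number of $K_n$). Write $G \rightarrow_{\mathrm{ind}} (H)_k$ if for every $c \colon E(G) \to \{1,\dotsc,k\}$ there are an $i \in \{1,\dotsc,k\}$ and an injection $\varphi \colon V(H) \to V(G)$ such that $\varphi(E(H)) \subseteq c^{-1}(i)$ and $\varphi(E(H)^c) \cap E(G) = \emptyset$, where $E(H)^c$ is the set of non-edges of $H$ (that is, every $k$-colouring of $E(G)$ contains a monochromatic induced copy of $H$). The $k$-colour induced Ramsey number of $H$ is \[ R_{\mathrm{ind}}(H;k) = \min\big\{N \in \mathbb{N} : G \rightarrow_{\mathrm{ind}} (H)_k \text{ for some } G \subseteq K_N\big\}. \]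
   Formalization: The second inequality is stated only for k ≥ 2, since at k = 1 it is false (log 1 = 0 while the middle term exceeds 1 for n ≥ 2); the first is proved for every positive k with the same C. The vertices of H are natural numbers. *)

theory Defs
  imports Complex_Main "HOL-Library.Ramsey" "HOL-Library.FuncSet"
begin

datatype 'a graph = Graph (verts: "'a set") (edges: "'a set set")

definition simple_graph :: "'a graph \<Rightarrow> bool" where
  "simple_graph G \<longleftrightarrow> finite (verts G) \<and> edges G \<subseteq> [verts G]\<^bsup>2\<^esup>"

definition complete_graph :: "nat \<Rightarrow> nat graph" where
  "complete_graph n = Graph {..<n} ([{..<n}]\<^bsup>2\<^esup>)"

definition subgraph :: "'a graph \<Rightarrow> 'a graph \<Rightarrow> bool" where
  "subgraph G G' \<longleftrightarrow> verts G \<subseteq> verts G' \<and> edges G \<subseteq> edges G'"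

definition contains_copy :: "'a graph \<Rightarrow> 'b graph \<Rightarrow> bool" where
  "contains_copy G H \<longleftrightarrow>
     (\<exists>\<phi>. inj_on \<phi> (verts H) \<and> \<phi> \<in> verts H \<rightarrow> verts G \<and> (\<lambda>e. \<phi> ` e) ` edges H \<subseteq> edges G)"

definition colour_class :: "'a graph \<Rightarrow> ('a set \<Rightarrow> nat) \<Rightarrow> nat \<Rightarrow> 'a graph" where
  "colour_class G c i = Graph (verts G) {e \<in> edges G. c e = i}"

definition arrows :: "'a graph \<Rightarrow> 'b graph \<Rightarrow> nat \<Rightarrow> bool" where
  "arrows G H k \<longleftrightarrow>
     (\<forall>c \<in> edges G \<rightarrow> {1..k}. \<exists>i \<in> {1..k}. contains_copy (colour_class G c i) H)"

definition induced_arrows :: "'a graph \<Rightarrow> 'b graph \<Rightarrow> nat \<Rightarrow> bool" where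
  "induced_arrows G H k \<longleftrightarrow>
     (\<forall>c \<in> edges G \<rightarrow> {1..k}. \<exists>i \<in> {1..k}. \<exists>\<phi>.
        inj_on \<phi> (verts H) \<and> \<phi> \<in> verts H \<rightarrow> verts G \<and>
        (\<lambda>e. \<phi> ` e) ` edges H \<subseteq> edges (colour_class G c i) \<and>
        (\<lambda>e. \<phi> ` e) ` ([verts H]\<^bsup>2\<^esup> - edges H) \<inter> edges G = {})"

definition ramsey_number :: "nat \<Rightarrow> nat \<Rightarrow> nat" where
  "ramsey_number n k = (LEAST N. arrows (complete_graph N) (complete_graph n) k)"

text \<open>The minimum defining \<^term>\<open>ramsey_number n k\<close> exists, so \<open>LEAST\<close> is not a junk value.\<close>

lemma ramsey_number_exists:
  assumes "k \<ge> 1"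
  shows "\<exists>N. arrows (complete_graph N) (complete_graph n) k"
proof -
  obtain N :: nat where N: "partn_lst {..<N} (replicate k n) 2"
    using ramsey_full[of "replicate k n" 2] by blast
  have "arrows (complete_graph N) (complete_graph n) k"
    unfolding arrows_def
  proof
    fix c assume c: "c \<in> edges (complete_graph N) \<rightarrow> {1..k}"
    define f where "f = (\<lambda>e. c e - 1)"
    have "f \<in> [{..<N}]\<^bsup>2\<^esup> \<rightarrow> {..<length (replicate k n)}"
      using c assms by (fastforce simp: f_def complete_graph_def Pi_iff)
    then obtain i H where i: "i < k" and H: "H \<in> [{..<N}]\<^bsup>n\<^esup>" and fH: "f ` [H]\<^bsup>2\<^esup> \<subseteq> {i}"
      using N unfolding partn_lst_def monochromatic_def by fastforce
    have fin: "finite H" and card: "card H = n" and sub: "H \<subseteq> {..<N}"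
      using H by (auto simp: nsets_def)
    obtain \<phi> where bij: "bij_betw \<phi> {..<n} H"
      using fin card by (metis card_lessThan finite_lessThan finite_same_card_bij)
    have inj: "inj_on \<phi> {..<n}" and im: "\<phi> ` {..<n} = H"
      using bij by (auto simp: bij_betw_def)
    have edge: "\<phi> ` e \<in> [{..<N}]\<^bsup>2\<^esup> \<and> c (\<phi> ` e) = Suc i" if "e \<in> [{..<n}]\<^bsup>2\<^esup>" for e
    proof -
      have eH: "\<phi> ` e \<in> [H]\<^bsup>2\<^esup>"
        using that inj im by (auto simp: nsets_def card_image inj_on_subset)
      then have eN: "\<phi> ` e \<in> [{..<N}]\<^bsup>2\<^esup>"
        using nsets_mono[OF sub] by blast
      then have "c (\<phi> ` e) \<ge> 1"
        using c by (auto simp: complete_graph_def Pi_iff)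
      moreover have "f (\<phi> ` e) = i"
        using fH eH by blast
      ultimately show ?thesis
        using eN by (simp add: f_def)
    qed
    have "contains_copy (colour_class (complete_graph N) c (Suc i)) (complete_graph n)"
      unfolding contains_copy_def colour_class_def complete_graph_def
      using inj im sub edge by (intro exI[of _ \<phi>]) auto
    with i show "\<exists>i \<in> {1..k}. contains_copy (colour_class (complete_graph N) c i) (complete_graph n)"
      by (intro bexI[of _ "Suc i"]) auto
  qed
  then show ?thesis ..
qed

definition induced_ramsey_host :: "'a graph \<Rightarrow> nat \<Rightarrow> nat \<Rightarrow> bool" where
  "induced_ramsey_host H k N \<longleftrightarrow>
     (\<exists>G. simple_graph G \<and> subgraph G (complete_graph N) \<and> induced_arrows G H k)"

text \<open>On an unsatisfiable predicate \<open>LEAST\<close> is an unspecified number, so an upper bound on the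
  following number is meaningful only together with \<^term>\<open>\<exists>N. induced_ramsey_host H k N\<close>.\<close>

definition induced_ramsey_number :: "'a graph \<Rightarrow> nat \<Rightarrow> nat" where
  "induced_ramsey_number H k = (LEAST N. induced_ramsey_host H k N)"

end

theory Submission
  imports Defs
begin

text \<open>
  Write \<open>R\<close> for the Ramsey number of \<open>n\<close> and \<open>k\<close>, and let \<open>N = D ^ (7 * n)\<close> with
  \<open>D = 100 * n\<^sup>2 * k * R\<close>. That some graph on \<open>N\<close> vertices is a host for \<open>H\<close> is shown by counting the
  graphs that are not, with the probabilistic hypergraph containers of Campos and Samotij.

  A graph with a \<open>k\<close>-coloured edge set is encoded by assigning to each pair of vertices its colour,
  or \<open>0\<close> if the pair is a non-edge. Sets of such (pair, type) tuples without an induced monochromatic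
  copy of \<open>H\<close> form a down-closed family \<open>F\<close>. The container lemma (\<open>container_lemma\<close>) covers \<open>F\<close> by
  few pairs \<open>(S, A)\<close>, in the sense that every member \<open>I\<close> satisfies \<open>S \<subseteq> I \<subseteq> S \<union> A\<close> for one of them, and
  such that \<open>S\<close> together with a \<open>p\<close>-random subset of \<open>A\<close> belongs to \<open>F\<close> with a probability that is not
  too small. Its proof is a greedy algorithm, analysed with the edge-isoperimetric inequality
  \<open>down_set_isoperimetry\<close>.

  A container \<open>(S, A)\<close> determines the graph outside the pairs for which \<open>A\<close> offers both a non-edge and
  some colour. Suppose that nearly all pairs are undecided in this sense. Then so are all pairs
  within at least half of the \<open>R\<close>-sets \<open>T\<close> of vertices. Colouring the pairs of \<open>T\<close> by colours that \<open>A\<close>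
  offers, Ramsey's property gives a monochromatic \<open>K\<^sub>n\<close> in \<open>T\<close>, and there \<open>A\<close> contains the encoding of a
  copy of \<open>H\<close>, non-edges included. These copies overlap rarely, because random \<open>R\<close>-sets do, so Janson's
  inequality (\<open>janson\<close>) shows that a random subset of \<open>A\<close> avoids them only with tiny probability,
  contrary to the choice of the containers. Hence each container decides more than a constant
  multiple of \<open>N\<^sup>2 / R\<^sup>2\<close> pairs, which outweighs the logarithm of the number of containers, and
  the containers together cannot account for all graphs on \<open>N\<close> vertices
  (\<open>induced_ramsey_host_bound\<close>).

  The second inequality is the bound \<open>R \<le> k ^ (k * n)\<close> of Erdos and Szekeres
  (\<open>ramsey_number_le\<close>) and a comparison of logarithms.
\<close>

section \<open>Random subsets of a finite set\<close>

text \<open>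
  The expectation of \<open>f R\<close> for the random \<open>R \<subseteq> A\<close> that contains each point independently with
  probability \<open>p\<close>. An explicit finite sum, rather than an integral over a product measure,
  turns every fact below into an induction on \<open>A\<close> that exposes one point at a time
  (\<open>expect_remove\<close>).
\<close>
definition expect :: "real \<Rightarrow> 'a set \<Rightarrow> ('a set \<Rightarrow> real) \<Rightarrow> real" where
  "expect p A f = (\<Sum>R\<in>Pow A. p ^ card R * (1 - p) ^ card (A - R) * f R)"

lemma expect_empty [simp]: "expect p {} f = f {}"
  by (simp add: expect_def)

lemma expect_cong:
  assumes "\<And>R. R \<subseteq> A \<Longrightarrow> f R = g R"
  shows "expect p A f = expect p A g"
  unfolding expect_def by (intro sum.cong) (auto simp: assms)

lemma expect_insert:
  assumes "finite A" "v \<notin> A"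
  shows "expect p (insert v A) f = (1 - p) * expect p A f + p * expect p A (\<lambda>R. f (insert v R))"
proof -
  have inj: "inj_on (insert v) (Pow A)"
    using assms(2) by (auto simp: inj_on_def)
  have without: "p ^ card R * (1 - p) ^ card (insert v A - R) * f R
      = (1 - p) * (p ^ card R * (1 - p) ^ card (A - R) * f R)" if "R \<in> Pow A" for R
  proof -
    have "insert v A - R = insert v (A - R)" "v \<notin> A - R" using that assms by auto
    then show ?thesis using assms by simp
  qed
  have with': "p ^ card (insert v R) * (1 - p) ^ card (insert v A - insert v R) * f (insert v R)
      = p * (p ^ card R * (1 - p) ^ card (A - R) * f (insert v R))" if "R \<in> Pow A" for R
  proof -
    have "insert v A - insert v R = A - R" and "card (insert v R) = Suc (card R)"
      using that assms finite_subset[of R A] by (auto intro!: card_insert_disjoint)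
    then show ?thesis by simp
  qed
  show ?thesis
    unfolding expect_def Pow_insert sum_distrib_left
  proof (subst sum.union_disjoint)
    show "(\<Sum>R\<in>Pow A. p ^ card R * (1 - p) ^ card (insert v A - R) * f R)
        + (\<Sum>R\<in>insert v ` Pow A. p ^ card R * (1 - p) ^ card (insert v A - R) * f R)
      = (\<Sum>R\<in>Pow A. (1 - p) * (p ^ card R * (1 - p) ^ card (A - R) * f R))
        + (\<Sum>R\<in>Pow A. p * (p ^ card R * (1 - p) ^ card (A - R) * f (insert v R)))"
      by (simp only: sum.reindex[OF inj] comp_def without with' cong: sum.cong)
  qed (use assms in auto)
qed

lemma expect_remove:
  assumes "finite A" "v \<in> A"
  shows "expect p A f
    = (1 - p) * expect p (A - {v}) f + p * expect p (A - {v}) (\<lambda>R. f (insert v R))"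
  using expect_insert[of "A - {v}" v p f] assms by (simp add: insert_absorb)

lemma expect_const [simp]: "finite A \<Longrightarrow> expect p A (\<lambda>_. c) = c"
  by (induction A rule: finite_induct) (simp_all add: expect_insert algebra_simps)

lemma expect_cmult: "expect p A (\<lambda>R. c * f R) = c * expect p A f"
  by (simp add: expect_def sum_distrib_left algebra_simps)

lemma expect_sum: "expect p A (\<lambda>R. \<Sum>j\<in>J. f j R) = (\<Sum>j\<in>J. expect p A (f j))"
  unfolding expect_def sum_distrib_left by (rule sum.swap)

lemma expect_mono:
  assumes "0 \<le> p" "p \<le> 1" "\<And>R. R \<subseteq> A \<Longrightarrow> f R \<le> g R"
  shows "expect p A f \<le> expect p A g"
  unfolding expect_def using assms by (intro sum_mono mult_left_mono) auto

lemma expect_nonneg: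
  assumes "0 \<le> p" "p \<le> 1" "\<And>R. R \<subseteq> A \<Longrightarrow> 0 \<le> f R"
  shows "0 \<le> expect p A f"
  unfolding expect_def using assms by (intro sum_nonneg mult_nonneg_nonneg) auto

lemma expect_ge_empty_outcome:
  assumes "finite A" "0 \<le> p" "p \<le> 1" "\<And>R. R \<subseteq> A \<Longrightarrow> 0 \<le> f R"
  shows "(1 - p) ^ card A * f {} \<le> expect p A f"
proof -
  have "(\<Sum>R\<in>{{}}. p ^ card R * (1 - p) ^ card (A - R) * f R) \<le> expect p A f"
    unfolding expect_def using assms by (intro sum_mono2) auto
  then show ?thesis by simp
qed

text \<open>
  Conditioned on \<open>h \<subseteq> R\<close>, the remaining part of \<open>R\<close> is still a \<open>p\<close>-random subset of \<open>A - h\<close>.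
\<close>
lemma expect_contains:
  assumes "finite h" "finite A" "h \<subseteq> A"
  shows "expect p A (\<lambda>R. of_bool (h \<subseteq> R) * f R) = p ^ card h * expect p (A - h) (\<lambda>R. f (R \<union> h))"
  using assms
proof (induction h arbitrary: A f rule: finite_induct)
  case (insert v h)
  have no: "expect p (A - {v}) (\<lambda>R. of_bool (insert v h \<subseteq> R) * f R) = 0"
    using insert.prems by (subst expect_cong[where g = "\<lambda>_. 0"]) auto
  have yes: "expect p (A - {v}) (\<lambda>R. of_bool (insert v h \<subseteq> insert v R) * f (insert v R))
      = expect p (A - {v}) (\<lambda>R. of_bool (h \<subseteq> R) * f (insert v R))"
    using insert.hyps by (intro expect_cong) auto
  have "expect p A (\<lambda>R. of_bool (insert v h \<subseteq> R) * f R)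
      = p * expect p (A - {v}) (\<lambda>R. of_bool (h \<subseteq> R) * f (insert v R))"
    using insert.prems by (subst expect_remove[of _ v]) (auto simp only: no yes)
  also have "\<dots> = p * (p ^ card h * expect p (A - {v} - h) (\<lambda>R. f (insert v (R \<union> h))))"
    using insert.prems insert.hyps by (subst insert.IH) auto
  also have "A - {v} - h = A - insert v h" by auto
  finally show ?case using insert.hyps by simp
qed simp

lemma expect_ignore:
  assumes "finite h" "finite A" "h \<subseteq> A" "\<And>v R. v \<in> h \<Longrightarrow> f (insert v R) = f R"
  shows "expect p A f = expect p (A - h) f"
  using assms
proof (induction h arbitrary: A rule: finite_induct)
  case (insert v h)
  have "expect p A f = expect p (A - {v}) f"
    using insert.prems by (subst expect_remove[of _ v]) (auto simp: algebra_simps)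
  also have "\<dots> = expect p (A - {v} - h) f"
    using insert.prems insert.hyps by (intro insert.IH) auto
  also have "A - {v} - h = A - insert v h" by auto
  finally show ?case .
qed simp

text \<open>
  Jensen's inequality for \<open>exp\<close>: integrate the tangent line at the mean.
\<close>
lemma exp_weighted_mean_le:
  fixes w y :: "'i \<Rightarrow> real"
  assumes "finite J" "\<And>j. j \<in> J \<Longrightarrow> 0 \<le> w j" "sum w J = 1"
  shows "exp (\<Sum>j\<in>J. w j * y j) \<le> (\<Sum>j\<in>J. w j * exp (y j))"
proof -
  define m where "m = (\<Sum>j\<in>J. w j * y j)"
  have "exp m * (1 + (y j - m)) \<le> exp (y j)" for j
    using mult_left_mono[OF exp_ge_add_one_self[of "y j - m"], of "exp m"]
    by (simp add: exp_diff)
  then have "(\<Sum>j\<in>J. w j * (exp m * (1 + (y j - m)))) \<le> (\<Sum>j\<in>J. w j * exp (y j))"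
    using assms by (intro sum_mono mult_left_mono) auto
  moreover have "(\<Sum>j\<in>J. w j * (exp m * (1 + (y j - m)))) = exp m * ((1 - m) * sum w J + m)"
  proof -
    have "(\<Sum>j\<in>J. w j * (exp m * (1 + (y j - m))))
        = (\<Sum>j\<in>J. exp m * ((1 - m) * w j) + exp m * (w j * y j))"
      by (intro sum.cong) (auto simp: algebra_simps)
    also have "\<dots> = exp m * ((1 - m) * sum w J) + exp m * m"
      by (simp only: sum.distrib sum_distrib_left [symmetric] m_def)
    finally show ?thesis by (simp add: algebra_simps)
  qed
  ultimately show ?thesis using assms by (simp add: m_def)
qed

lemma expect_exp_ge:
  assumes "finite A" "0 \<le> p" "p \<le> 1"
  shows "exp (expect p A f) \<le> expect p A (\<lambda>R. exp (f R))"
proof -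
  have "(\<Sum>R\<in>Pow A. p ^ card R * (1 - p) ^ card (A - R)) = 1"
    using expect_const[of A p 1] assms by (simp add: expect_def)
  then show ?thesis
    unfolding expect_def using assms by (intro exp_weighted_mean_le) auto
qed

text \<open>
  Harris' correlation inequality. When one point is exposed, each of the two expectations can only
  drop, and the gain is \<open>p * (1 - p)\<close> times the product of the two drops.
\<close>
lemma harris:
  assumes "finite A" "0 \<le> p" "p \<le> 1"
    and "\<And>R R'. R \<subseteq> R' \<Longrightarrow> f R' \<le> f R" "\<And>R R'. R \<subseteq> R' \<Longrightarrow> g R' \<le> g R"
  shows "expect p A f * expect p A g \<le> expect p A (\<lambda>R. f R * g R)"
  using assms(1,4,5)
proof (induction A arbitrary: f g rule: finite_induct)
  case (insert v A)
  let ?f = "\<lambda>R. f (insert v R)" and ?g = "\<lambda>R. g (insert v R)"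
  have mono: "expect p A ?f \<le> expect p A f" "expect p A ?g \<le> expect p A g"
    using assms(2,3) insert.prems by (auto intro!: expect_mono subset_insertI)
  have IH0: "expect p A f * expect p A g \<le> expect p A (\<lambda>R. f R * g R)"
    by (intro insert.IH insert.prems)
  have IH1: "expect p A ?f * expect p A ?g \<le> expect p A (\<lambda>R. ?f R * ?g R)"
    by (intro insert.IH insert.prems insert_mono)
  have "0 \<le> p * (1 - p) * ((expect p A f - expect p A ?f) * (expect p A g - expect p A ?g))"
    using assms(2,3) mono by (intro mult_nonneg_nonneg) auto
  then have "((1 - p) * expect p A f + p * expect p A ?f) * ((1 - p) * expect p A g + p * expect p A ?g)
      \<le> (1 - p) * (expect p A f * expect p A g) + p * (expect p A ?f * expect p A ?g)"
    by (simp add: algebra_simps)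
  also have "\<dots> \<le> (1 - p) * expect p A (\<lambda>R. f R * g R) + p * expect p A (\<lambda>R. ?f R * ?g R)"
    using assms(2,3) IH0 IH1 by (intro add_mono mult_left_mono) auto
  finally show ?case
    using insert.hyps by (simp add: expect_insert)
qed simp

section \<open>Isoperimetry for down-closed families\<close>

definition down_closed :: "('a set \<Rightarrow> bool) \<Rightarrow> bool" where
  "down_closed F \<longleftrightarrow> (\<forall>R R'. R \<subseteq> R' \<longrightarrow> F R' \<longrightarrow> F R)"

lemma down_closedD: "down_closed F \<Longrightarrow> R \<subseteq> R' \<Longrightarrow> F R' \<Longrightarrow> F R"
  unfolding down_closed_def by blast

lemma down_closed_link: "down_closed F \<Longrightarrow> down_closed (\<lambda>R. F (S \<union> R))"
  unfolding down_closed_def by (meson Un_mono subset_refl)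

text \<open>
  The inductive step of the isoperimetric inequality below, for a single point whose presence
  lowers the conditional probability of the family from \<open>a\<close> to \<open>b\<close>. It is sharp at \<open>b = 0\<close> and at
  \<open>b = a\<close>, so constants cannot be spared; it follows from \<open>1 - 1 / z \<le> ln z\<close> applied at three
  points, because the three lower bounds add up to \<open>p * (1 - p) * b * (a - b) / P \<ge> 0\<close>.
\<close>
lemma entropy_two_point:
  fixes a b p :: real
  assumes p: "0 < p" "p < 1" and ab: "0 \<le> b" "b \<le> a" "0 < a"
  defines "P \<equiv> (1 - p) * a + p * b"
  shows "(1 - p) * (a * ln a) + p * (b * ln b) - P * ln P \<le> - ln (1 - p) * ((1 - p) * (a - b))"
proof -
  have P_pos: "0 < P" using p ab unfolding P_def by (intro add_pos_nonneg) auto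
  have tangent: "1 - x / P \<le> ln P - ln x" if "0 < x" for x
    using ln_le_minus_one[of "x / P"] that P_pos by (simp add: ln_div)
  have t1: "(1 - p) * (a - b) * (1 - (1 - p) * a / P) \<le> (1 - p) * (a - b) * (ln P - ln ((1 - p) * a))"
    using p ab by (intro mult_left_mono tangent) auto
  have t2: "p * (b * (1 - b / P)) \<le> p * (b * (ln P - ln b))"
    using p ab tangent[of b] by (cases "b = 0") (auto intro!: mult_left_mono)
  have t3: "(1 - p) * b * (1 - a / P) \<le> (1 - p) * b * (ln P - ln a)"
    using p ab by (intro mult_left_mono tangent) auto
  have "(1 - p) * (a - b) * (1 - (1 - p) * a / P) + p * (b * (1 - b / P)) + (1 - p) * b * (1 - a / P)
      = p * (1 - p) * b * (a - b) / P"
    using P_pos by (simp add: divide_simps) (simp add: P_def algebra_simps)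
  moreover have "0 \<le> p * (1 - p) * b * (a - b) / P"
    using p ab P_pos by simp
  ultimately have "0 \<le> (1 - p) * (a - b) * (ln P - ln ((1 - p) * a)) + p * (b * (ln P - ln b))
      + (1 - p) * b * (ln P - ln a)"
    using t1 t2 t3 by linarith
  also have "ln ((1 - p) * a) = ln (1 - p) + ln a"
    using p ab by (simp add: ln_mult)
  finally show ?thesis
    by (simp add: P_def algebra_simps)
qed

text \<open>
  The edge-isoperimetric inequality of the \<open>p\<close>-biased cube. A down-closed family of small
  probability \<open>P\<close> must be sensitive to some points: the \<open>v\<close>-th summand is what the family loses
  when \<open>v\<close> is forced into the random set. There is equality for the family of all sets that avoid
  a fixed \<open>B \<subseteq> A\<close>, where \<open>P = (1 - p) ^ card B\<close>.
\<close>
lemma down_set_isoperimetry: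
  assumes "finite A" "0 < p" "p < 1" "down_closed F" "F {}"
  defines "P \<equiv> expect p A (\<lambda>R. of_bool (F R))"
  shows "- (P * ln P)
    \<le> - ln (1 - p) * (\<Sum>v\<in>A. P - expect p (A - {v}) (\<lambda>R. of_bool (F (insert v R))))"
  using assms(1,4,5) unfolding P_def
proof (induction A arbitrary: F rule: finite_induct)
  case (insert v A)
  let ?s = "- ln (1 - p)" and ?F = "\<lambda>R. F (insert v R)"
  define a where "a = expect p A (\<lambda>R. of_bool (F R))"
  define b where "b = expect p A (\<lambda>R. of_bool (?F R))"
  define P where "P = (1 - p) * a + p * b"
  define Da where "Da = (\<Sum>u\<in>A. a - expect p (A - {u}) (\<lambda>R. of_bool (F (insert u R))))"
  define Db where "Db = (\<Sum>u\<in>A. b - expect p (A - {u}) (\<lambda>R. of_bool (?F (insert u R))))"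
  have P_eq: "expect p (insert v A) (\<lambda>R. of_bool (F R)) = P"
    using insert.hyps by (simp add: expect_insert P_def a_def b_def)
  have "0 < (1 - p) ^ card A" using assms by simp
  also have "\<dots> \<le> a"
    using expect_ge_empty_outcome[of A p "\<lambda>R. of_bool (F R)"] insert.hyps insert.prems(2) assms
    by (simp add: a_def)
  finally have a_pos: "0 < a" .
  have b_nonneg: "0 \<le> b"
    unfolding b_def using assms by (intro expect_nonneg) auto
  have ba: "b \<le> a"
    unfolding a_def b_def using assms down_closedD[OF insert.prems(1) subset_insertI]
    by (intro expect_mono) auto
  have IHa: "- (a * ln a) \<le> ?s * Da"
    unfolding a_def Da_def using insert.IH[of F] insert.prems by blast
  have IHb: "- (b * ln b) \<le> ?s * Db"
  proof (cases "F {v}")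
    case True
    have "down_closed ?F"
      using down_closed_link[OF insert.prems(1), of "{v}"] by simp
    then show ?thesis
      unfolding b_def Db_def using insert.IH[of ?F] True by blast
  next
    \<comment> \<open>No member of \<open>F\<close> contains \<open>v\<close>, so the induction hypothesis does not cover the second half.\<close>
    case False
    then have none: "\<not> F (insert v R)" for R
      using down_closedD[OF insert.prems(1), of "{v}" "insert v R"] by auto
    then have "b = 0" "Db = 0"
      using insert.hyps by (simp_all add: b_def Db_def)
    then show ?thesis by simp
  qed
  have other: "expect p (insert v A - {u}) (\<lambda>R. of_bool (F (insert u R)))
      = (1 - p) * expect p (A - {u}) (\<lambda>R. of_bool (F (insert u R)))
        + p * expect p (A - {u}) (\<lambda>R. of_bool (?F (insert u R)))" if "u \<in> A" for u
  proof -
    have "insert v A - {u} = insert v (A - {u})" using that insert.hyps by auto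
    then show ?thesis
      using insert.hyps by (simp add: expect_insert insert_commute)
  qed
  have "(\<Sum>u\<in>insert v A. P - expect p (insert v A - {u}) (\<lambda>R. of_bool (F (insert u R))))
      = (P - b) + (\<Sum>u\<in>A. P - expect p (insert v A - {u}) (\<lambda>R. of_bool (F (insert u R))))"
    using insert.hyps by (simp add: b_def)
  also have "(\<Sum>u\<in>A. P - expect p (insert v A - {u}) (\<lambda>R. of_bool (F (insert u R))))
      = (\<Sum>u\<in>A. (1 - p) * (a - expect p (A - {u}) (\<lambda>R. of_bool (F (insert u R))))
          + p * (b - expect p (A - {u}) (\<lambda>R. of_bool (?F (insert u R)))))"
    by (intro sum.cong refl) (simp add: other P_def algebra_simps)
  also have "\<dots> = (1 - p) * Da + p * Db"
    by (simp add: Da_def Db_def sum.distrib sum_distrib_left)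
  also have "P - b = (1 - p) * (a - b)"
    by (simp add: P_def algebra_simps)
  finally have total: "(\<Sum>u\<in>insert v A. P - expect p (insert v A - {u}) (\<lambda>R. of_bool (F (insert u R))))
      = (1 - p) * (a - b) + ((1 - p) * Da + p * Db)" .
  have "- (P * ln P) \<le> ?s * ((1 - p) * (a - b)) + (1 - p) * (- (a * ln a)) + p * (- (b * ln b))"
    using entropy_two_point[OF assms(2,3) b_nonneg ba a_pos] by (simp add: P_def)
  also have "\<dots> \<le> ?s * ((1 - p) * (a - b)) + (1 - p) * (?s * Da) + p * (?s * Db)"
    using assms IHa IHb by (intro add_mono mult_left_mono) auto
  finally show ?case
    unfolding P_eq total by (simp add: algebra_simps)
qed simp

section \<open>Containers\<close>

text \<open>
  By the isoperimetric inequality, as long as the random set lies in \<open>F\<close> with probability below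
  \<open>(1 - p)\<close> to the power \<open>\<delta> * card A\<close>, some point loses at least the average: forcing it into the
  set costs a factor \<open>1 - \<delta>\<close>.
\<close>
lemma container_step_vertex:
  assumes "finite A" "0 < p" "p < 1" "down_closed F" "F {}"
    and small: "expect p A (\<lambda>R. of_bool (F R)) < exp (ln (1 - p) * \<delta> * card A)"
  obtains v where "v \<in> A"
    "expect p (A - {v}) (\<lambda>R. of_bool (F (insert v R))) \<le> (1 - \<delta>) * expect p A (\<lambda>R. of_bool (F R))"
proof (rule ccontr)
  define P where "P = expect p A (\<lambda>R. of_bool (F R))"
  assume "\<not> thesis"
  with that have large: "(1 - \<delta>) * P \<le> expect p (A - {v}) (\<lambda>R. of_bool (F (insert v R)))"
    if "v \<in> A" for v using that unfolding P_def by fastforce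
  have "0 < (1 - p) ^ card A" using assms by simp
  also have "\<dots> \<le> P"
    using expect_ge_empty_outcome[of A p "\<lambda>R. of_bool (F R)"] assms by (simp add: P_def)
  finally have P_pos: "0 < P" .
  have "- (P * ln P)
      \<le> - ln (1 - p) * (\<Sum>v\<in>A. P - expect p (A - {v}) (\<lambda>R. of_bool (F (insert v R))))"
    unfolding P_def using assms by (intro down_set_isoperimetry) auto
  also have "\<dots> \<le> - ln (1 - p) * (\<Sum>v\<in>A. \<delta> * P)"
    using assms large by (intro mult_left_mono sum_mono) (auto simp: algebra_simps)
  finally have "P * (ln (1 - p) * \<delta> * card A) \<le> P * ln P"
    by (simp add: algebra_simps)
  then have "ln (1 - p) * \<delta> * card A \<le> ln P"
    using P_pos by simp
  then have "exp (ln (1 - p) * \<delta> * card A) \<le> P"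
    using P_pos by (metis exp_le_cancel_iff exp_ln)
  with small show False by (simp add: P_def)
qed

text \<open>
  The state \<open>(S, A)\<close> of the container algorithm records that \<open>S \<subseteq> I \<subseteq> S \<union> A\<close> for the unknown member
  \<open>I\<close> of \<open>F\<close>. The algorithm queries the point from \<open>container_step_vertex\<close> and stops when there is
  none. The potential is \<open>Q / (1 - p) ^ card A\<close>, where \<open>Q\<close> is the probability that \<open>S\<close> together with a
  random subset of \<open>A\<close> belongs to \<open>F\<close>. It never increases, it drops at least by the factor \<open>1 - \<delta>\<close> with every positive answer, and
  it stays at least 1 since \<open>S\<close> itself belongs to \<open>F\<close>; so there are few positive answers, and hence
  few leaves. By induction, their number is at most the \<open>\<theta>\<close>-th power of the potential times
  one factor \<open>1 + (1 - \<delta>) ^ \<theta>\<close> for each query: the summand 1 accounts for a negative answer, the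
  other one for a positive answer.
\<close>
lemma container_lemma_relative:
  fixes F :: "'a set \<Rightarrow> bool" and \<theta> :: nat and p \<delta> :: real
  assumes "finite A" "0 < p" "p < 1" "\<delta> \<le> 1" "down_closed F"
  shows "\<exists>\<C>. finite \<C>
    \<and> (1 - p) ^ (card A * \<theta>) * card \<C>
        \<le> (1 + (1 - \<delta>) ^ \<theta>) ^ card A * expect p A (\<lambda>R. of_bool (F (S \<union> R))) ^ \<theta>
    \<and> (\<forall>I. F I \<and> S \<subseteq> I \<and> I \<subseteq> S \<union> A \<longrightarrow> (\<exists>(S', A')\<in>\<C>. S' \<subseteq> I \<and> I \<subseteq> S' \<union> A'))
    \<and> (\<forall>(S', A')\<in>\<C>. A' \<subseteq> A \<and>
          exp (ln (1 - p) * \<delta> * card A') \<le> expect p A' (\<lambda>R. of_bool (F (S' \<union> R))))"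
  using assms(1)
proof (induction "card A" arbitrary: A S rule: less_induct)
  case less
  let ?y = "(1 - \<delta>) ^ \<theta>" and ?Q = "\<lambda>S A. expect p A (\<lambda>R. of_bool (F (S \<union> R)))"
  have y_nonneg: "0 \<le> ?y" using assms by simp
  have Q_nonneg: "0 \<le> ?Q S A" for S A
    using assms by (intro expect_nonneg) auto
  consider "\<not> F S" | "F S" "exp (ln (1 - p) * \<delta> * card A) \<le> ?Q S A"
    | "F S" "?Q S A < exp (ln (1 - p) * \<delta> * card A)" by linarith
  then show ?case
  proof cases
    case 1
    then show ?thesis
      using down_closedD[OF assms(5)] y_nonneg Q_nonneg by (intro exI[of _ "{}"]) auto
  next
    case 2
    have "(1 - p) ^ card A \<le> ?Q S A"
      using expect_ge_empty_outcome[of A p "\<lambda>R. of_bool (F (S \<union> R))"] assms less.prems 2 by simp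
    then have "((1 - p) ^ card A) ^ \<theta> \<le> ?Q S A ^ \<theta>"
      using assms by (intro power_mono) auto
    also have "\<dots> \<le> (1 + ?y) ^ card A * ?Q S A ^ \<theta>"
      using y_nonneg mult_right_mono[of 1 "(1 + ?y) ^ card A" "?Q S A ^ \<theta>"] Q_nonneg by simp
    finally show ?thesis
      using 2 by (intro exI[of _ "{(S, A)}"]) (auto simp: power_mult)
  next
    case 3
    obtain v where v: "v \<in> A" and
      drop: "?Q (insert v S) (A - {v}) \<le> (1 - \<delta>) * ?Q S A"
    proof (rule container_step_vertex[of A p "\<lambda>R. F (S \<union> R)" \<delta>])
      show "down_closed (\<lambda>R. F (S \<union> R))" by (rule down_closed_link[OF assms(5)])
    qed (use 3 less.prems assms in auto)
    have card_A: "card A = Suc (card (A - {v}))"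
      using v less.prems by (metis card.remove)
    have keep: "(1 - p) * ?Q S (A - {v}) \<le> ?Q S A"
      using expect_remove[OF less.prems v, of p "\<lambda>R. of_bool (F (S \<union> R))"] assms(2,3)
        expect_nonneg[of p "A - {v}" "\<lambda>R. of_bool (F (S \<union> insert v R))"] by simp
    have smaller: "card (A - {v}) < card A" "finite (A - {v})"
      using card_A less.prems by auto
    obtain C1 where C1: "finite C1"
      "(1 - p) ^ (card (A - {v}) * \<theta>) * card C1
        \<le> (1 + ?y) ^ card (A - {v}) * ?Q (insert v S) (A - {v}) ^ \<theta>"
      "\<forall>I. F I \<and> insert v S \<subseteq> I \<and> I \<subseteq> insert v S \<union> (A - {v})
        \<longrightarrow> (\<exists>(S', A')\<in>C1. S' \<subseteq> I \<and> I \<subseteq> S' \<union> A')"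
      "\<forall>(S', A')\<in>C1. A' \<subseteq> A - {v} \<and> exp (ln (1 - p) * \<delta> * card A') \<le> ?Q S' A'"
      using less.hyps[OF smaller, of "insert v S"] by (elim exE conjE)
    obtain C2 where C2: "finite C2"
      "(1 - p) ^ (card (A - {v}) * \<theta>) * card C2
        \<le> (1 + ?y) ^ card (A - {v}) * ?Q S (A - {v}) ^ \<theta>"
      "\<forall>I. F I \<and> S \<subseteq> I \<and> I \<subseteq> S \<union> (A - {v})
        \<longrightarrow> (\<exists>(S', A')\<in>C2. S' \<subseteq> I \<and> I \<subseteq> S' \<union> A')"
      "\<forall>(S', A')\<in>C2. A' \<subseteq> A - {v} \<and> exp (ln (1 - p) * \<delta> * card A') \<le> ?Q S' A'"
      using less.hyps[OF smaller, of S] by (elim exE conjE)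
    let ?a = "card (A - {v})"
    have "(1 - p) ^ (card A * \<theta>) * card (C1 \<union> C2)
        \<le> (1 - p) ^ (card A * \<theta>) * (real (card C1) + card C2)"
      using assms card_Un_le[of C1 C2] by (intro mult_left_mono) auto
    also have "\<dots> = (1 - p) ^ \<theta> * ((1 - p) ^ (?a * \<theta>) * card C1)
        + (1 - p) ^ \<theta> * ((1 - p) ^ (?a * \<theta>) * card C2)"
      by (simp add: card_A power_add algebra_simps)
    also have "\<dots> \<le> 1 * ((1 + ?y) ^ ?a * ?Q (insert v S) (A - {v}) ^ \<theta>)
        + (1 - p) ^ \<theta> * ((1 + ?y) ^ ?a * ?Q S (A - {v}) ^ \<theta>)"
      using assms
      by (intro add_mono mult_mono[OF _ C1(2)] mult_left_mono[OF C2(2)]) (simp_all add: power_le_one)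
    also have "\<dots> = (1 + ?y) ^ ?a * (?Q (insert v S) (A - {v}) ^ \<theta> + ((1 - p) * ?Q S (A - {v})) ^ \<theta>)"
      by (simp only: power_mult_distrib distrib_left mult_1 mult.left_commute)
    also have "\<dots> \<le> (1 + ?y) ^ ?a * (((1 - \<delta>) * ?Q S A) ^ \<theta> + ?Q S A ^ \<theta>)"
      using drop keep Q_nonneg[of "A - {v}" "insert v S"] Q_nonneg[of "A - {v}" S] assms(3) y_nonneg
      by (intro mult_left_mono add_mono power_mono) simp_all
    also have "\<dots> = (1 + ?y) ^ ?a * (?y * ?Q S A ^ \<theta> + ?Q S A ^ \<theta>)"
      by (simp only: power_mult_distrib)
    also have "\<dots> = (1 + ?y) ^ card A * ?Q S A ^ \<theta>"
      unfolding card_A power_Suc by (simp add: algebra_simps)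
    finally have bound: "(1 - p) ^ (card A * \<theta>) * card (C1 \<union> C2) \<le> (1 + ?y) ^ card A * ?Q S A ^ \<theta>" .
    have cover: "\<exists>(S', A')\<in>C1 \<union> C2. S' \<subseteq> I \<and> I \<subseteq> S' \<union> A'"
      if I: "F I \<and> S \<subseteq> I \<and> I \<subseteq> S \<union> A" for I
    proof (cases "v \<in> I")
      case True
      then have "F I \<and> insert v S \<subseteq> I \<and> I \<subseteq> insert v S \<union> (A - {v})" using I by auto
      then have "\<exists>(S', A')\<in>C1. S' \<subseteq> I \<and> I \<subseteq> S' \<union> A'"
        by (rule C1(3)[rule_format])
      then show ?thesis by (simp only: bex_Un simp_thms)
    next
      case False
      then have "F I \<and> S \<subseteq> I \<and> I \<subseteq> S \<union> (A - {v})" using I by auto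
      then have "\<exists>(S', A')\<in>C2. S' \<subseteq> I \<and> I \<subseteq> S' \<union> A'"
        by (rule C2(3)[rule_format])
      then show ?thesis by (simp only: bex_Un simp_thms)
    qed
    have stop: "\<forall>(S', A')\<in>C1 \<union> C2. A' \<subseteq> A \<and> exp (ln (1 - p) * \<delta> * card A') \<le> ?Q S' A'"
      using C1(4) C2(4) by fast
    show ?thesis
      using bound cover stop C1(1) C2(1) by (intro exI[of _ "C1 \<union> C2"] conjI allI impI) simp_all
  qed
qed

text \<open>
  The form in which the algorithm is used, started from \<open>({}, A)\<close>. With \<open>\<theta>\<close> a large multiple
  of \<open>1 / \<delta>\<close> and \<open>p\<close> much smaller than \<open>1 / \<theta>\<close>, the exponent is a small fraction of \<open>card A\<close>.
\<close>
lemma container_lemma: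
  fixes F :: "'a set \<Rightarrow> bool" and \<theta> :: nat and p \<delta> :: real
  assumes "finite A" "0 < p" "p < 1" "\<delta> \<le> 1" "down_closed F"
  obtains \<C> where "finite \<C>"
    "card \<C> \<le> exp (card A * ((1 - \<delta>) ^ \<theta> - \<theta> * ln (1 - p)))"
    "\<And>I. F I \<Longrightarrow> I \<subseteq> A \<Longrightarrow> \<exists>(S', A')\<in>\<C>. S' \<subseteq> I \<and> I \<subseteq> S' \<union> A'"
    "\<And>S' A'. (S', A') \<in> \<C> \<Longrightarrow> A' \<subseteq> A \<and>
      exp (ln (1 - p) * \<delta> * card A') \<le> expect p A' (\<lambda>R. of_bool (F (S' \<union> R)))"
proof -
  let ?y = "(1 - \<delta>) ^ \<theta>" and ?Q = "expect p A (\<lambda>R. of_bool (F ({} \<union> R)))"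
  obtain \<C> where C: "finite \<C>"
    "(1 - p) ^ (card A * \<theta>) * card \<C> \<le> (1 + ?y) ^ card A * ?Q ^ \<theta>"
    "\<forall>I. F I \<and> {} \<subseteq> I \<and> I \<subseteq> {} \<union> A \<longrightarrow> (\<exists>(S', A')\<in>\<C>. S' \<subseteq> I \<and> I \<subseteq> S' \<union> A')"
    "\<forall>(S', A')\<in>\<C>. A' \<subseteq> A \<and>
      exp (ln (1 - p) * \<delta> * card A') \<le> expect p A' (\<lambda>R. of_bool (F (S' \<union> R)))"
    using container_lemma_relative[where F = F and S = "{}" and \<theta> = \<theta>, OF assms] by (elim exE conjE)
  have y: "0 \<le> ?y" using assms by simp
  have "?Q \<le> expect p A (\<lambda>_. 1)"
    using assms by (intro expect_mono) auto
  then have Q1: "?Q \<le> 1" using assms by simp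
  have Q0: "0 \<le> ?Q"
    using assms by (intro expect_nonneg) auto
  have "(1 - p) ^ (card A * \<theta>) * card \<C> \<le> (1 + ?y) ^ card A * ?Q ^ \<theta>"
    by (rule C(2))
  also have "\<dots> \<le> exp ?y ^ card A * 1"
    using y Q0 Q1 by (intro mult_mono power_mono power_le_one) auto
  also have "\<dots> = exp (card A * ?y)"
    by (simp only: exp_of_nat_mult mult_1_right)
  finally have "(1 - p) ^ (card A * \<theta>) * card \<C> \<le> exp (card A * ?y)" .
  moreover have "(1 - p) ^ (card A * \<theta>) = exp (card A * (\<theta> * ln (1 - p)))"
    using assms by (simp add: exp_of_nat_mult [of "card A * \<theta>" "ln (1 - p)", simplified mult.assoc of_nat_mult])
  ultimately have "card \<C> \<le> exp (card A * ?y) / exp (card A * (\<theta> * ln (1 - p)))"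
    by (subst pos_le_divide_eq) (simp_all add: mult.commute)
  also have "\<dots> = exp (card A * (?y - \<theta> * ln (1 - p)))"
    by (simp only: exp_diff [symmetric] right_diff_distrib)
  finally show ?thesis
  proof (rule that[OF C(1)])
    show "\<exists>(S', A')\<in>\<C>. S' \<subseteq> I \<and> I \<subseteq> S' \<union> A'" if "F I" "I \<subseteq> A" for I
      using that by (intro C(3)[rule_format]) simp
    show "A' \<subseteq> A \<and> exp (ln (1 - p) * \<delta> * card A') \<le> expect p A' (\<lambda>R. of_bool (F (S' \<union> R)))"
      if "(S', A') \<in> \<C>" for S' A'
      using bspec[OF C(4) that] by simp
  qed
qed

section \<open>Janson's inequality with weights\<close>

text \<open>
  The quantity \<open>\<Delta> / \<mu>\<^sup>2\<close> of Janson's inequality for the variable that counts the inclusions \<open>h j \<subseteq> R\<close> with weight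
  \<open>w j / p ^ card (h j)\<close>, normalised so that \<open>\<mu> = sum w J = 1\<close>.
\<close>
definition overlap_weight :: "real \<Rightarrow> ('i \<Rightarrow> real) \<Rightarrow> ('i \<Rightarrow> 'a set) \<Rightarrow> 'i set \<Rightarrow> real" where
  "overlap_weight p w h J
    = (\<Sum>j\<in>J. w j * (\<Sum>l\<in>{l\<in>J. h l \<inter> h j \<noteq> {}}. w l / p ^ card (h l \<inter> h j)))"

context
  fixes p :: real and w :: "'i \<Rightarrow> real" and h :: "'i \<Rightarrow> 'a set" and J :: "'i set" and A :: "'a set"
    and X :: "'a set \<Rightarrow> real"
  assumes finite: "finite J" "finite A" and sub: "\<And>j. j \<in> J \<Longrightarrow> h j \<subseteq> A"
    and p: "0 < p" "p \<le> 1"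
    and w: "\<And>j. j \<in> J \<Longrightarrow> 0 \<le> w j" "sum w J = 1"
  defines "X \<equiv> \<lambda>R. \<Sum>j\<in>J. w j / p ^ card (h j) * of_bool (h j \<subseteq> R)"
begin

text \<open>
  Let \<open>X = Y + Z\<close>, where \<open>Y\<close> collects the sets that meet \<open>h j\<close>. Conditioned on \<open>h j \<subseteq> R\<close>, the part
  \<open>Z\<close> keeps its distribution, Harris' inequality separates the two factors, and Jensen's inequality
  evaluates the factor of \<open>Y\<close>.
\<close>
lemma conditioned_tilt_lower_bound:
  assumes "0 \<le> t" "j \<in> J"
  shows "exp (- t * (\<Sum>l\<in>{l\<in>J. h l \<inter> h j \<noteq> {}}. w l / p ^ card (h l \<inter> h j)))
      * expect p A (\<lambda>R. exp (- t * X R)) \<le> expect p (A - h j) (\<lambda>R. exp (- t * X (R \<union> h j)))"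
proof -
  let ?N = "{l\<in>J. h l \<inter> h j \<noteq> {}}" and ?M = "{l\<in>J. h l \<inter> h j = {}}"
  define Y where "Y R = (\<Sum>l\<in>?N. w l / p ^ card (h l) * of_bool (h l \<subseteq> R \<union> h j))" for R
  define Z where "Z R = (\<Sum>l\<in>?M. w l / p ^ card (h l) * of_bool (h l \<subseteq> R))" for R
  have finN: "finite ?N" "finite ?M" and part: "J = ?N \<union> ?M" "?N \<inter> ?M = {}" using finite by auto
  have fin_h: "finite (h l)" if "l \<in> J" for l using sub[OF that] finite finite_subset by blast
  have coeff: "0 \<le> w l / p ^ card (h l)" if "l \<in> J" for l using w(1)[OF that] p by simp
  have Z_union: "Z (R \<union> h j) = Z R" for R
    unfolding Z_def by (intro sum.cong refl) (auto simp: subset_eq)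
  have split: "X (R \<union> h j) = Y R + Z R" for R
  proof -
    have "X (R \<union> h j) = Y R + Z (R \<union> h j)"
      unfolding X_def Y_def Z_def by (subst part(1)) (simp add: sum.union_disjoint finN part(2))
    then show ?thesis by (simp add: Z_union)
  qed
  have EY: "expect p (A - h j) Y = (\<Sum>l\<in>?N. w l / p ^ card (h l \<inter> h j))"
  proof -
    have "expect p (A - h j) Y
        = (\<Sum>l\<in>?N. w l / p ^ card (h l) * expect p (A - h j) (\<lambda>R. of_bool (h l \<subseteq> R \<union> h j)))"
      unfolding Y_def by (simp only: expect_sum expect_cmult)
    also have "\<dots> = (\<Sum>l\<in>?N. w l / p ^ card (h l \<inter> h j))"
    proof (intro sum.cong refl)
      fix l assume "l \<in> ?N"
      then have l: "l \<in> J" by simp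
      have "expect p (A - h j) (\<lambda>R. of_bool (h l \<subseteq> R \<union> h j))
          = expect p (A - h j) (\<lambda>R. of_bool (h l - h j \<subseteq> R) * 1)"
        by (intro expect_cong) (auto simp: subset_eq)
      also have "\<dots> = p ^ card (h l - h j)"
        using fin_h[OF l] finite sub[OF l] by (subst expect_contains) auto
      also have "\<dots> = p ^ card (h l) / p ^ card (h l \<inter> h j)"
      proof -
        have "card (h l) = card (h l - h j) + card (h l \<inter> h j)"
          using fin_h[OF l] by (metis card_Int_Diff add.commute)
        then show ?thesis using p by (simp add: power_add)
      qed
      finally show "w l / p ^ card (h l) * expect p (A - h j) (\<lambda>R. of_bool (h l \<subseteq> R \<union> h j))
          = w l / p ^ card (h l \<inter> h j)"
        using p by simp
    qed
    finally show ?thesis .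
  qed
  have Y_mono: "Y R \<le> Y R'" and Z_mono: "Z R \<le> Z R'" if "R \<subseteq> R'" for R R'
    unfolding Y_def Z_def using that coeff by (intro sum_mono mult_left_mono; auto)+
  have "exp (- t * (\<Sum>l\<in>?N. w l / p ^ card (h l \<inter> h j))) = exp (expect p (A - h j) (\<lambda>R. - t * Y R))"
    by (simp only: expect_cmult EY)
  also have "\<dots> \<le> expect p (A - h j) (\<lambda>R. exp (- t * Y R))"
    using finite p by (intro expect_exp_ge) auto
  finally have near: "exp (- t * (\<Sum>l\<in>?N. w l / p ^ card (h l \<inter> h j)))
      \<le> expect p (A - h j) (\<lambda>R. exp (- t * Y R))" .
  have "expect p A (\<lambda>R. exp (- t * X R)) \<le> expect p A (\<lambda>R. exp (- t * Z R))"
  proof (rule expect_mono)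
    fix R
    have "Z R \<le> X R"
      unfolding Z_def X_def using finite coeff by (intro sum_mono2) auto
    then show "exp (- t * X R) \<le> exp (- t * Z R)"
      using assms(1) by (simp add: mult_left_mono)
  qed (use p in auto)
  also have "\<dots> = expect p (A - h j) (\<lambda>R. exp (- t * Z R))"
  proof (rule expect_ignore)
    fix v R assume "v \<in> h j"
    then have "Z (insert v R) = Z R"
      unfolding Z_def by (intro sum.cong refl) (auto simp: subset_eq)
    then show "exp (- t * Z (insert v R)) = exp (- t * Z R)" by simp
  qed (use finite sub fin_h assms(2) in auto)
  finally have far: "expect p A (\<lambda>R. exp (- t * X R)) \<le> expect p (A - h j) (\<lambda>R. exp (- t * Z R))" .
  have "0 \<le> expect p A (\<lambda>R. exp (- t * X R))"
    using p by (intro expect_nonneg) auto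
  moreover have "0 \<le> expect p (A - h j) (\<lambda>R. exp (- t * Y R))"
    using p by (intro expect_nonneg) auto
  ultimately have "exp (- t * (\<Sum>l\<in>?N. w l / p ^ card (h l \<inter> h j))) * expect p A (\<lambda>R. exp (- t * X R))
      \<le> expect p (A - h j) (\<lambda>R. exp (- t * Y R)) * expect p (A - h j) (\<lambda>R. exp (- t * Z R))"
    by (intro mult_mono near far)
  also have "\<dots> \<le> expect p (A - h j) (\<lambda>R. exp (- t * Y R) * exp (- t * Z R))"
    using finite p assms(1) Y_mono Z_mono by (intro harris) (auto intro: mult_left_mono)
  also have "\<dots> = expect p (A - h j) (\<lambda>R. exp (- t * X (R \<union> h j)))"
    by (simp add: split exp_add [symmetric] algebra_simps)
  finally show ?thesis .
qed

text \<open>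
  Up to the sign, the right-hand side is the derivative in \<open>t\<close> of the expectation on the left.
\<close>
lemma tilted_mean_lower_bound:
  assumes "0 \<le> t"
  shows "exp (- t * overlap_weight p w h J) * expect p A (\<lambda>R. exp (- t * X R))
      \<le> expect p A (\<lambda>R. X R * exp (- t * X R))"
proof -
  let ?L = "expect p A (\<lambda>R. exp (- t * X R))"
  let ?o = "\<lambda>j. \<Sum>l\<in>{l\<in>J. h l \<inter> h j \<noteq> {}}. w l / p ^ card (h l \<inter> h j)"
  have L_nonneg: "0 \<le> ?L"
    using p by (intro expect_nonneg) auto
  have "exp (- t * overlap_weight p w h J) = exp (\<Sum>j\<in>J. w j * (- t * ?o j))"
    by (simp add: overlap_weight_def sum_distrib_left algebra_simps sum_negf)
  also have "\<dots> \<le> (\<Sum>j\<in>J. w j * exp (- t * ?o j))"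
    using finite w by (intro exp_weighted_mean_le) auto
  finally have "exp (- t * overlap_weight p w h J) * ?L \<le> (\<Sum>j\<in>J. w j * exp (- t * ?o j)) * ?L"
    using L_nonneg by (rule mult_right_mono)
  also have "\<dots> = (\<Sum>j\<in>J. w j * (exp (- t * ?o j) * ?L))"
    by (simp add: sum_distrib_right mult.assoc)
  also have "\<dots> \<le> (\<Sum>j\<in>J. w j * expect p (A - h j) (\<lambda>R. exp (- t * X (R \<union> h j))))"
    using w assms by (intro sum_mono mult_left_mono conditioned_tilt_lower_bound) auto
  also have "\<dots> = (\<Sum>j\<in>J. w j / p ^ card (h j) * expect p A (\<lambda>R. of_bool (h j \<subseteq> R) * exp (- t * X R)))"
  proof (intro sum.cong refl)
    fix j assume "j \<in> J"
    then have "expect p A (\<lambda>R. of_bool (h j \<subseteq> R) * exp (- t * X R))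
        = p ^ card (h j) * expect p (A - h j) (\<lambda>R. exp (- t * X (R \<union> h j)))"
      using finite sub finite_subset by (intro expect_contains) blast+
    then show "w j * expect p (A - h j) (\<lambda>R. exp (- t * X (R \<union> h j)))
      = w j / p ^ card (h j) * expect p A (\<lambda>R. of_bool (h j \<subseteq> R) * exp (- t * X R))"
      using p by simp
  qed
  also have "\<dots> = expect p A (\<lambda>R. X R * exp (- t * X R))"
    by (simp add: X_def sum_distrib_right expect_sum expect_cmult [symmetric] mult.assoc)
  finally show ?thesis .
qed

end

text \<open>
  The Laplace transform \<open>L\<close> of \<open>X\<close> bounds the probability of \<open>X = 0\<close> at every \<open>t\<close>, and
  \<open>tilted_mean_lower_bound\<close> is the differential inequality \<open>(ln L)' \<le> - exp (- t * \<eta>)\<close>. Weights make it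
  possible to count the sets \<open>h j\<close> with an arbitrary multiplicity, as needed when \<open>h j\<close> is chosen
  inside a random object \<open>j\<close>.
\<close>
lemma janson:
  fixes h :: "'i \<Rightarrow> 'a set"
  assumes finite: "finite J" "finite A" and sub: "\<And>j. j \<in> J \<Longrightarrow> h j \<subseteq> A"
    and p: "0 < p" "p \<le> 1"
    and w: "\<And>j. j \<in> J \<Longrightarrow> 0 \<le> w j" "sum w J = 1"
    and overlap: "overlap_weight p w h J \<le> \<eta>" "0 < \<eta>"
  shows "expect p A (\<lambda>R. of_bool (\<forall>j\<in>J. \<not> h j \<subseteq> R)) \<le> exp (- 1 / (2 * \<eta>))"
proof -
  define X where "X R = (\<Sum>j\<in>J. w j / p ^ card (h j) * of_bool (h j \<subseteq> R))" for R
  define L where "L t = expect p A (\<lambda>R. exp (- t * X R))" for t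
  define g where "g t = ln (L t) - exp (- t * \<eta>) / \<eta>" for t
  \<comment> \<open>This makes \<open>exp (- t * \<eta>)\<close> equal to \<open>1 / 2\<close>, which is the source of the factor 2 in the bound.\<close>
  define t where "t = ln 2 / \<eta>"
  have L_pos: "0 < L t" for t
  proof -
    have "exp (expect p A (\<lambda>R. - t * X R)) \<le> L t"
      unfolding L_def using finite p by (intro expect_exp_ge) auto
    then show ?thesis by (meson exp_gt_zero less_le_trans)
  qed
  have deriv_L: "(L has_real_derivative - expect p A (\<lambda>R. X R * exp (- t * X R))) (at t)" for t
    unfolding L_def expect_def
    by (auto intro!: derivative_eq_intros simp: sum_negf [symmetric] algebra_simps)
  have deriv_g: "(g has_real_derivative
      (- expect p A (\<lambda>R. X R * exp (- t * X R)) / L t + exp (- t * \<eta>))) (at t)" for t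
    unfolding g_def using L_pos[of t] overlap(2)
    by (auto intro!: derivative_eq_intros deriv_L simp: field_simps)
  have "g t \<le> g 0"
  proof (rule DERIV_nonpos_imp_nonincreasing[where f = g and a = 0 and b = t])
    show "0 \<le> t" using overlap by (simp add: t_def)
    fix s :: real assume s: "0 \<le> s" "s \<le> t"
    have "exp (- s * \<eta>) * L s \<le> exp (- s * overlap_weight p w h J) * L s"
      using s overlap L_pos[of s] by (intro mult_right_mono) (auto intro: mult_left_mono)
    also have "\<dots> \<le> expect p A (\<lambda>R. X R * exp (- s * X R))"
      unfolding L_def X_def
      using tilted_mean_lower_bound[OF finite sub p w s(1)] by auto
    finally have "- expect p A (\<lambda>R. X R * exp (- s * X R)) / L s + exp (- s * \<eta>) \<le> 0"
      using L_pos[of s] by (simp add: field_simps)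
    then show "\<exists>y. (g has_real_derivative y) (at s) \<and> y \<le> 0"
      using deriv_g by blast
  qed
  moreover have "g 0 = - 1 / \<eta>"
    using finite by (simp add: g_def L_def)
  moreover have "exp (- t * \<eta>) = 1 / 2"
    using overlap by (simp add: t_def exp_minus)
  ultimately have "ln (L t) - (1 / 2) / \<eta> \<le> - 1 / \<eta>"
    by (simp only: g_def)
  moreover have "(1 / 2) / \<eta> - 1 / \<eta> = - 1 / (2 * \<eta>)"
    using overlap(2) by (simp add: field_simps)
  ultimately have "ln (L t) \<le> - 1 / (2 * \<eta>)"
    by linarith
  then have "L t \<le> exp (- 1 / (2 * \<eta>))"
    using L_pos[of t] by (metis exp_le_cancel_iff exp_ln)
  moreover have "expect p A (\<lambda>R. of_bool (\<forall>j\<in>J. \<not> h j \<subseteq> R)) \<le> L t"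
    unfolding L_def using p by (intro expect_mono) (auto simp: X_def)
  ultimately show ?thesis by simp
qed

section \<open>Multicolour Ramsey numbers\<close>

lemma ramsey_number_arrows:
  "k \<ge> 1 \<Longrightarrow> arrows (complete_graph (ramsey_number n k)) (complete_graph n) k"
  unfolding ramsey_number_def by (rule LeastI_ex) (rule ramsey_number_exists)

lemma image_nsets:
  assumes "inj_on f X" "e \<in> [X]\<^bsup>m\<^esup>"
  shows "f ` e \<in> [f ` X]\<^bsup>m\<^esup>"
  using assms by (auto simp: nsets_def card_image inj_on_subset)

text \<open>
  Ramsey's property, transported from the complete graph on \<open>{..<R}\<close> to an arbitrary \<open>R\<close>-set.
\<close>
lemma arrows_monochromatic_subset:
  assumes arr: "arrows (complete_graph R) (complete_graph n) k"
    and T: "finite T" "card T = R" and \<chi>: "\<chi> \<in> [T]\<^bsup>2\<^esup> \<rightarrow> {1..k}"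
  obtains V i where "V \<subseteq> T" "card V = n" "i \<in> {1..k}" "\<And>e. e \<in> [V]\<^bsup>2\<^esup> \<Longrightarrow> \<chi> e = i"
proof -
  obtain f where f: "bij_betw f {..<R} T"
    using T by (metis card_lessThan finite_lessThan finite_same_card_bij)
  then have injf: "inj_on f {..<R}" and imf: "f ` {..<R} = T"
    by (auto simp: bij_betw_def)
  have "(\<lambda>e. \<chi> (f ` e)) \<in> edges (complete_graph R) \<rightarrow> {1..k}"
    using \<chi> image_nsets[OF injf] imf by (auto simp: complete_graph_def Pi_iff)
  then obtain i where i: "i \<in> {1..k}"
    and "contains_copy (colour_class (complete_graph R) (\<lambda>e. \<chi> (f ` e)) i) (complete_graph n)"
    using arr unfolding arrows_def by blast
  then obtain \<phi> where inj: "inj_on \<phi> {..<n}" and im: "\<phi> \<in> {..<n} \<rightarrow> {..<R}"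
    and mono: "(\<lambda>e. \<phi> ` e) ` [{..<n}]\<^bsup>2\<^esup> \<subseteq> {e \<in> [{..<R}]\<^bsup>2\<^esup>. \<chi> (f ` e) = i}"
    unfolding contains_copy_def complete_graph_def colour_class_def graph.sel by (elim exE conjE)
  have injc: "inj_on (f \<circ> \<phi>) {..<n}"
    using inj im injf by (intro comp_inj_on) (auto intro: inj_on_subset)
  show ?thesis
  proof (rule that[of "(f \<circ> \<phi>) ` {..<n}" i])
    show "(f \<circ> \<phi>) ` {..<n} \<subseteq> T" using im imf by auto
    show "card ((f \<circ> \<phi>) ` {..<n}) = n" using card_image[OF injc] by simp
    show "i \<in> {1..k}" by (rule i)
    fix e assume e: "e \<in> [(f \<circ> \<phi>) ` {..<n}]\<^bsup>2\<^esup>"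
    then obtain d where d: "d \<subseteq> {..<n}" "e = (f \<circ> \<phi>) ` d"
      by (auto simp: nsets_def subset_image_iff)
    then have "d \<in> [{..<n}]\<^bsup>2\<^esup>"
      using e card_image[OF inj_on_subset[OF injc d(1)]] finite_subset[OF d(1)]
      by (simp only: nsets_def mem_Collect_eq d(2)) (simp add: d(1))
    then show "\<chi> e = i" using mono d by (auto simp: image_comp)
  qed
qed

lemma ramsey_number_ge:
  assumes "k \<ge> 1" shows "n \<le> ramsey_number n k"
proof -
  obtain V i where "V \<subseteq> {..<ramsey_number n k}" "card V = n"
    using arrows_monochromatic_subset[OF ramsey_number_arrows[OF assms], of "{..<ramsey_number n k}" n "\<lambda>_. 1"]
      assms by auto
  then show ?thesis
    using card_mono[of "{..<ramsey_number n k}" V] by simp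
qed

text \<open>
  The argument of Erdos and Szekeres: a point of \<open>X\<close> has at least \<open>k ^ (m - 1)\<close> neighbours in some
  colour \<open>i\<close> if \<open>card X \<ge> k ^ m\<close>, where \<open>m\<close> is the sum of the target sizes; recurse into these
  neighbours with the target for colour \<open>i\<close> lowered by 1. For \<open>k = 1\<close> the pigeonhole step, and the
  bound itself, fail.
\<close>
lemma multicolour_ramsey_bound:
  fixes f :: "nat \<Rightarrow> nat"
  assumes k: "k \<ge> 2" and "finite X" "\<chi> \<in> [X]\<^bsup>2\<^esup> \<rightarrow> {1..k}" "k ^ (\<Sum>i=1..k. f i) \<le> card X"
  shows "\<exists>i\<in>{1..k}. \<exists>V\<subseteq>X. card V = f i \<and> (\<forall>e\<in>[V]\<^bsup>2\<^esup>. \<chi> e = i)"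
  using assms(2-4)
proof (induction "\<Sum>i=1..k. f i" arbitrary: f X)
  case 0
  then have "f 1 = 0" using k by auto
  then show ?case using k by (intro bexI[of _ 1] exI[of _ "{}"]) (auto simp: nsets_def)
next
  case (Suc m f X)
  show ?case
  proof (cases "\<exists>i\<in>{1..k}. f i = 0")
    case True
    then obtain i where "i \<in> {1..k}" "f i = 0" by blast
    then show ?thesis by (intro bexI[of _ i] exI[of _ "{}"]) (auto simp: nsets_def)
  next
    case False
    have m: "(\<Sum>i=1..k. f i) = Suc m" using Suc.hyps by simp
    have "card X > 0" using Suc.prems(3) k by (metis gr0I le_zero_eq not_numeral_le_zero power_eq_0_iff)
    then obtain x where x: "x \<in> X" by fastforce
    define Nb where "Nb i = {y \<in> X - {x}. \<chi> {x, y} = i}" for i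
    have finNb: "finite (Nb i)" for i using Suc.prems by (simp add: Nb_def)
    have edge: "{x, y} \<in> [X]\<^bsup>2\<^esup>" if "y \<in> X" "y \<noteq> x" for y
      using that x by (auto simp: nsets_def card_insert_if)
    have "X - {x} \<subseteq> (\<Union>i\<in>{1..k}. Nb i)"
      using Suc.prems(2) edge by (fastforce simp: Nb_def Pi_iff)
    then have "card (X - {x}) \<le> card (\<Union>i\<in>{1..k}. Nb i)"
      using finNb by (intro card_mono) auto
    also have "\<dots> \<le> (\<Sum>i=1..k. card (Nb i))"
      by (intro card_UN_le) auto
    finally have le: "card X - 1 \<le> (\<Sum>i=1..k. card (Nb i))"
      using x Suc.prems by simp
    have "\<exists>i\<in>{1..k}. k ^ m \<le> card (Nb i)"
    proof (rule ccontr)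
      assume "\<not> ?thesis"
      then have "card (Nb i) \<le> k ^ m - 1" if "i \<in> {1..k}" for i
        using that by (metis One_nat_def Suc_pred less_Suc_eq_le not_le_imp_less zero_less_power k less_le_trans pos2)
      then have "(\<Sum>i=1..k. card (Nb i)) \<le> (\<Sum>i=1..k. k ^ m - 1)"
        by (rule sum_mono)
      also have "\<dots> = k * k ^ m - k" by (simp add: right_diff_distrib')
      finally have "card X - 1 \<le> k * k ^ m - k" using le by simp
      moreover have "k * k ^ m \<le> card X" using Suc.prems(3) m by simp
      moreover have "k \<le> k * k ^ m" using k by simp
      ultimately show False using k by linarith
    qed
    then obtain i where i: "i \<in> {1..k}" "k ^ m \<le> card (Nb i)" by blast
    have fi: "f i > 0" using False i by auto
    define g where "g = f(i := f i - 1)"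
    have gm: "(\<Sum>j=1..k. g j) = m"
    proof -
      have "(\<Sum>j=1..k. f j) = f i + (\<Sum>j\<in>{1..k} - {i}. f j)"
        using i by (intro sum.remove) auto
      moreover have "(\<Sum>j=1..k. g j) = g i + (\<Sum>j\<in>{1..k} - {i}. g j)"
        using i by (intro sum.remove) auto
      moreover have "(\<Sum>j\<in>{1..k} - {i}. g j) = (\<Sum>j\<in>{1..k} - {i}. f j)"
        by (intro sum.cong) (auto simp: g_def)
      ultimately show ?thesis using m fi by (simp add: g_def)
    qed
    have sub: "Nb i \<subseteq> X" by (auto simp: Nb_def)
    have "\<exists>j\<in>{1..k}. \<exists>V\<subseteq>Nb i. card V = g j \<and> (\<forall>e\<in>[V]\<^bsup>2\<^esup>. \<chi> e = j)"
      using Suc.prems(2) nsets_mono[OF sub, of 2] gm i finNb by (intro Suc.hyps(1)) auto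
    then obtain j V where j: "j \<in> {1..k}" and V: "V \<subseteq> Nb i" "card V = g j" "\<forall>e\<in>[V]\<^bsup>2\<^esup>. \<chi> e = j"
      by blast
    show ?thesis
    proof (cases "j = i")
      case False
      then show ?thesis using j V sub by (intro bexI[of _ j] exI[of _ V]) (auto simp: g_def)
    next
      case True
      have finV: "finite V" and xV: "x \<notin> V"
        using V(1) finNb finite_subset by (auto simp: Nb_def)
      have "\<chi> e = i" if e: "e \<in> [insert x V]\<^bsup>2\<^esup>" for e
      proof (cases "x \<in> e")
        case True
        obtain a b where ab: "e = {a, b}" "a \<noteq> b" "a \<in> insert x V" "b \<in> insert x V"
          using e by (auto simp: nsets_2_eq)
        with True obtain y where "e = {x, y}" "y \<in> V" by auto
        then show ?thesis using V(1) by (auto simp: Nb_def)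
      next
        case False
        then have "e \<in> [V]\<^bsup>2\<^esup>" using e by (auto simp: nsets_def)
        then show ?thesis using V(3) True \<open>j = i\<close> by auto
      qed
      moreover have "card (insert x V) = f i"
        using finV xV V(2) True fi by (simp add: g_def)
      ultimately show ?thesis
        using i V(1) sub x by (intro bexI[of _ i] exI[of _ "insert x V"]) auto
    qed
  qed
qed

lemma ramsey_number_le:
  assumes "k \<ge> 2" shows "ramsey_number n k \<le> k ^ (k * n)"
  unfolding ramsey_number_def
proof (rule Least_le)
  let ?N = "k ^ (k * n)"
  show "arrows (complete_graph ?N) (complete_graph n) k"
    unfolding arrows_def
  proof
    fix c assume "c \<in> edges (complete_graph ?N) \<rightarrow> {1..k}"
    then have "c \<in> [{..<?N}]\<^bsup>2\<^esup> \<rightarrow> {1..k}" by (simp add: complete_graph_def)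
    then obtain i V where i: "i \<in> {1..k}" and V: "V \<subseteq> {..<?N}" "card V = n" "\<forall>e\<in>[V]\<^bsup>2\<^esup>. c e = i"
      using multicolour_ramsey_bound[OF assms, of "{..<?N}" c "\<lambda>_. n"] by auto
    obtain \<phi> where "bij_betw \<phi> {..<n} V"
      using V finite_subset by (metis card_lessThan finite_lessThan finite_same_card_bij)
    then have inj: "inj_on \<phi> {..<n}" and im: "\<phi> ` {..<n} = V" by (auto simp: bij_betw_def)
    have "\<phi> ` e \<in> [{..<?N}]\<^bsup>2\<^esup> \<and> c (\<phi> ` e) = i" if "e \<in> [{..<n}]\<^bsup>2\<^esup>" for e
      using image_nsets[OF inj that] V nsets_mono[OF V(1), of 2] im by auto
    then have "contains_copy (colour_class (complete_graph ?N) c i) (complete_graph n)"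
      unfolding contains_copy_def colour_class_def complete_graph_def
      using inj im V(1) by (intro exI[of _ \<phi>]) auto
    with i show "\<exists>i\<in>{1..k}. contains_copy (colour_class (complete_graph ?N) c i) (complete_graph n)"
      by blast
  qed
qed

section \<open>Overlaps of random subsets of fixed size\<close>

text \<open>
  A uniformly random \<open>R\<close>-subset of \<open>X\<close> contains a given \<open>m\<close>-set with probability at most
  \<open>(R / card X) ^ m\<close>.
\<close>
lemma card_supersets_le:
  assumes "finite X" "M \<subseteq> X"
  shows "real (card {T \<in> [X]\<^bsup>R\<^esup>. M \<subseteq> T}) \<le> (R / card X) ^ card M * (card X choose R)"
proof -
  have "finite M" using assms finite_subset by blast
  then show ?thesis
    using assms
  proof (induction M arbitrary: X R rule: finite_induct)
    case empty
    then show ?case by simp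
  next
    case (insert v M)
    let ?l = "card {T \<in> [X]\<^bsup>R\<^esup>. insert v M \<subseteq> T}"
    have fin: "finite T" if "T \<subseteq> X" for T using that insert.prems finite_subset by blast
    consider "R = 0" | "card X < R" | r x where "R = Suc r" "card X = Suc x" "r \<le> x"
      by (metis (no_types, opaque_lifting) Suc_le_mono not0_implies_Suc not_le zero_le le_zero_eq)
    then show ?case
    proof cases
      case 1
      then have "{T \<in> [X]\<^bsup>R\<^esup>. insert v M \<subseteq> T} = {}" by auto
      then show ?thesis by (simp only: card.empty) simp
    next
      case 2
      then have "[X]\<^bsup>R\<^esup> = {}"
        using insert.prems by (simp add: nsets_eq_empty)
      then have "{T \<in> [X]\<^bsup>R\<^esup>. insert v M \<subseteq> T} = {}" by simp
      then show ?thesis by (simp only: card.empty) simp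
    next
      case 3
      have "{T \<in> [X]\<^bsup>R\<^esup>. insert v M \<subseteq> T} \<subseteq> insert v ` {T \<in> [X - {v}]\<^bsup>r\<^esup>. M \<subseteq> T}"
      proof
        fix T assume T: "T \<in> {T \<in> [X]\<^bsup>R\<^esup>. insert v M \<subseteq> T}"
        then have "T - {v} \<in> {T \<in> [X - {v}]\<^bsup>r\<^esup>. M \<subseteq> T}" and "T = insert v (T - {v})"
          using insert.hyps 3 by (auto simp: nsets_def)
        then show "T \<in> insert v ` {T \<in> [X - {v}]\<^bsup>r\<^esup>. M \<subseteq> T}" by blast
      qed
      then have "?l \<le> card {T \<in> [X - {v}]\<^bsup>r\<^esup>. M \<subseteq> T}"
        using insert.prems by (intro surj_card_le) (auto simp: finite_imp_finite_nsets)
      also have "real \<dots> \<le> (r / card (X - {v})) ^ card M * (card (X - {v}) choose r)"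
        using insert.prems insert.hyps by (intro insert.IH) auto
      finally have "?l \<le> (r / x) ^ card M * (x choose r)"
        using insert.prems 3 by simp
      also have "\<dots> \<le> (R / card X) ^ card M * (x choose r)"
      proof -
        have "r / x \<le> R / card X"
          using 3 by (cases "x = 0") (auto simp: field_simps)
        then show ?thesis by (intro mult_right_mono power_mono) auto
      qed
      also have "real (x choose r) = R / card X * (card X choose R)"
      proof -
        have "Suc x * (x choose r) = (Suc x choose Suc r) * Suc r"
          by (rule Suc_times_binomial_eq)
        then have "real (Suc x) * real (x choose r) = real (Suc x choose Suc r) * real (Suc r)"
          by (metis of_nat_mult)
        then show ?thesis unfolding 3 by (simp add: field_simps del: of_nat_Suc)
      qed
      also have "(R / card X) ^ card M * \<dots> = (R / card X) ^ card (insert v M) * (card X choose R)"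
        using insert.hyps by simp
      finally show ?thesis .
    qed
  qed
qed

text \<open>
  If \<open>x\<close> is tiny compared with \<open>p ^ (n - 1)\<close>, then enlarging an overlap \<open>W\<close> by one point, which has
  probability about \<open>x\<close>, costs more than the at most \<open>n - 1\<close> additional shared pairs can gain. So the
  overlaps in a single pair dominate. This comparison is what forces the host to have about
  \<open>p\<close> to the power \<open>- n\<close> vertices.
\<close>
lemma sum_overlap_sets_le:
  fixes x p :: real
  assumes V: "finite V" "card V = n" and p: "0 < p" "p \<le> 1" and x: "0 \<le> x" "2 * (n * x) \<le> p ^ (n - 1)"
  shows "(\<Sum>W\<in>{W\<in>Pow V. 2 \<le> card W}. x ^ card W / p ^ (card W choose 2)) \<le> 2 * (n * x)\<^sup>2 / p"
proof -
  define a where "a m = (n * x) ^ m / p ^ (m choose 2)" for m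
  have a_nonneg: "0 \<le> a m" for m using p x by (simp add: a_def)
  \<comment> \<open>The ratio of consecutive terms is \<open>n * x / p ^ m \<le> 1 / 2\<close>, so a geometric series remains.\<close>
  have decay: "a (2 + j) \<le> a 2 * (1/2) ^ j" if "2 + j \<le> n" for j
    using that
  proof (induction j)
    case (Suc j)
    have "a (2 + Suc j) = a (2 + j) * (n * x / p ^ (2 + j))"
    proof -
      have "2 + Suc j choose 2 = (2 + j choose 2) + (2 + j)" by (simp add: numeral_2_eq_2)
      then show ?thesis by (simp add: a_def power_add mult_ac)
    qed
    also have "\<dots> \<le> a (2 + j) * (1 / 2)"
    proof (intro mult_left_mono a_nonneg)
      have "p ^ (n - 1) \<le> p ^ (2 + j)" using p Suc.prems by (intro power_decreasing) auto
      then show "n * x / p ^ (2 + j) \<le> 1 / 2" using p x(2) by (simp add: field_simps)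
    qed
    also have "\<dots> \<le> a 2 * (1/2) ^ j * (1 / 2)" using Suc by (intro mult_right_mono) auto
    finally show ?case by simp
  qed simp
  have "{W\<in>Pow V. 2 \<le> card W} = (\<Union>m\<in>{2..n}. [V]\<^bsup>m\<^esup>)"
    using V card_mono[OF V(1)] finite_subset[OF _ V(1)] by (auto simp: nsets_def)
  then have "(\<Sum>W\<in>{W\<in>Pow V. 2 \<le> card W}. x ^ card W / p ^ (card W choose 2))
      = (\<Sum>m\<in>{2..n}. \<Sum>W\<in>[V]\<^bsup>m\<^esup>. x ^ card W / p ^ (card W choose 2))"
    using V by (simp only:) (intro sum.UNION_disjoint, auto simp: finite_imp_finite_nsets, auto simp: nsets_def)
  also have "\<dots> = (\<Sum>m\<in>{2..n}. \<Sum>W\<in>[V]\<^bsup>m\<^esup>. x ^ m / p ^ (m choose 2))"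
    by (intro sum.cong refl) (auto simp: nsets_def)
  also have "\<dots> = (\<Sum>m\<in>{2..n}. (n choose m) * (x ^ m / p ^ (m choose 2)))"
    using V by simp
  also have "\<dots> \<le> (\<Sum>m\<in>{2..n}. a m)"
  proof (intro sum_mono)
    fix m assume "m \<in> {2..n}"
    then have "real (n choose m) \<le> real n ^ m" using binomial_le_pow[of m n] by (metis atLeastAtMost_iff of_nat_le_iff of_nat_power)
    then have "real (n choose m) * (x ^ m / p ^ (m choose 2)) \<le> real n ^ m * (x ^ m / p ^ (m choose 2))"
      using x p by (intro mult_right_mono) auto
    then show "real (n choose m) * (x ^ m / p ^ (m choose 2)) \<le> a m"
      by (simp add: a_def power_mult_distrib)
  qed
  also have "\<dots> \<le> 2 * a 2"
  proof (cases "2 \<le> n")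
    case True
    have "(\<Sum>m\<in>{2..n}. a m) = (\<Sum>j\<in>{..<n-1}. a (2 + j))"
      using True
      by (intro sum.reindex_bij_witness[of _ "\<lambda>j. 2 + j" "\<lambda>m. m - 2"]) (auto simp del: add_2_eq_Suc)
    also have "\<dots> \<le> (\<Sum>j\<in>{..<n-1}. a 2 * (1/2) ^ j)"
      by (intro sum_mono decay) auto
    also have "\<dots> = a 2 * (\<Sum>j\<in>{..<n-1}. (1/2) ^ j)"
      by (simp only: sum_distrib_left)
    also have "\<dots> \<le> a 2 * 2"
    proof (intro mult_left_mono a_nonneg)
      show "(\<Sum>j\<in>{..<n-1}. (1/2) ^ j) \<le> (2::real)"
        by (subst sum_gp_strict) (auto simp: field_simps)
    qed
    finally show ?thesis by simp
  qed (use a_nonneg in auto)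
  finally show ?thesis by (simp add: a_def)
qed

section \<open>Copies of H among the undecided pairs\<close>

text \<open>
  A graph on \<open>X\<close> with a \<open>k\<close>-coloured edge set is encoded by the set of all \<open>(e, i)\<close> such that the
  edge \<open>e\<close> has colour \<open>i\<close>, or \<open>e\<close> is a non-edge and \<open>i = 0\<close>. For such a set, this is the existence of
  an induced monochromatic copy of \<open>H\<close>. Recording the non-edges makes the absence of a copy a
  down-closed property, although being an induced subgraph is not monotone in the edge set.
\<close>
definition has_coloured_copy :: "'b graph \<Rightarrow> nat \<Rightarrow> 'a set \<Rightarrow> ('a set \<times> nat) set \<Rightarrow> bool" where
  "has_coloured_copy H k X I \<longleftrightarrow> (\<exists>i\<in>{1..k}. \<exists>\<phi>. inj_on \<phi> (verts H) \<and> \<phi> \<in> verts H \<rightarrow> X \<and>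
     (\<forall>e\<in>edges H. (\<phi> ` e, i) \<in> I) \<and> (\<forall>e\<in>[verts H]\<^bsup>2\<^esup> - edges H. (\<phi> ` e, 0) \<in> I))"

lemma has_coloured_copy_mono: "has_coloured_copy H k X I \<Longrightarrow> I \<subseteq> I' \<Longrightarrow> has_coloured_copy H k X I'"
  unfolding has_coloured_copy_def by (meson subset_iff)

text \<open>
  The pairs that a container with second component \<open>A\<close> may leave open to being an edge or not.
\<close>
definition undecided_pairs :: "nat \<Rightarrow> 'a set \<Rightarrow> ('a set \<times> nat) set \<Rightarrow> 'a set set" where
  "undecided_pairs k X A = {e \<in> [X]\<^bsup>2\<^esup>. (e, 0) \<in> A \<and> (\<exists>i\<in>{1..k}. (e, i) \<in> A)}"

text \<open>
  Colour each pair of \<open>T\<close> by one of the colours available in \<open>A\<close>. On the vertex set \<open>V\<close> of a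
  monochromatic clique, \<open>A\<close> offers both the common colour and the non-edge for every pair, so any
  placement of \<open>H\<close> onto \<open>V\<close> can be realised inside \<open>A\<close>. The set \<open>h\<close> of types used has exactly one type
  for each pair of \<open>V\<close>.
\<close>
lemma coloured_copy_in_clique:
  fixes H :: "'b graph"
  assumes H: "simple_graph H" "card (verts H) = n"
    and arr: "arrows (complete_graph R) (complete_graph n) k"
    and T: "finite T" "T \<subseteq> X" "card T = R" "[T]\<^bsup>2\<^esup> \<subseteq> undecided_pairs k X A"
  shows "\<exists>V h. V \<subseteq> T \<and> card V = n \<and> h \<subseteq> A \<and> inj_on fst h \<and> fst ` h = [V]\<^bsup>2\<^esup>
    \<and> (\<forall>I. h \<subseteq> I \<longrightarrow> has_coloured_copy H k X I)"
proof -
  define \<chi> where "\<chi> e = (SOME i. i \<in> {1..k} \<and> (e, i) \<in> A)" for e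
  have \<chi>: "\<chi> e \<in> {1..k}" "(e, \<chi> e) \<in> A" "(e, 0) \<in> A" if "e \<in> [T]\<^bsup>2\<^esup>" for e
  proof -
    from that T have e: "(e, 0) \<in> A" "\<exists>i. i \<in> {1..k} \<and> (e, i) \<in> A"
      unfolding undecided_pairs_def by blast+
    from someI_ex[OF e(2)] show "\<chi> e \<in> {1..k}" "(e, \<chi> e) \<in> A" unfolding \<chi>_def by auto
    show "(e, 0) \<in> A" by (rule e(1))
  qed
  obtain V i where V: "V \<subseteq> T" "card V = n" and i: "i \<in> {1..k}" and mono: "\<And>e. e \<in> [V]\<^bsup>2\<^esup> \<Longrightarrow> \<chi> e = i"
    using arrows_monochromatic_subset[OF arr T(1,3), of \<chi>] \<chi>(1) by auto
  have "finite V" "finite (verts H)"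
    using V(1) T(1) finite_subset H(1) by (auto simp: simple_graph_def)
  then obtain \<phi> where \<phi>: "bij_betw \<phi> (verts H) V"
    using H(2) V(2) by (metis finite_same_card_bij)
  then have inj: "inj_on \<phi> (verts H)" and im: "\<phi> ` verts H = V" by (auto simp: bij_betw_def)
  have edgesH: "edges H \<subseteq> [verts H]\<^bsup>2\<^esup>" using H(1) by (simp add: simple_graph_def)
  \<comment> \<open>One type for each pair of \<open>V\<close>: the image of \<open>H\<close> in colour \<open>i\<close>, and non-edges elsewhere.\<close>
  define h where "h = (\<lambda>e. (e, if e \<in> (\<lambda>d. \<phi> ` d) ` edges H then i else 0)) ` [V]\<^bsup>2\<^esup>"
  have im2: "\<phi> ` e \<in> [V]\<^bsup>2\<^esup>" if "e \<in> [verts H]\<^bsup>2\<^esup>" for e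
    using image_nsets[OF inj that] im by simp
  have "h \<subseteq> A"
  proof -
    have "(e, i) \<in> A \<and> (e, 0) \<in> A" if e: "e \<in> [V]\<^bsup>2\<^esup>" for e
      using \<chi>(2,3)[of e] mono[OF e] nsets_mono[OF V(1), of 2] e by auto
    then show ?thesis unfolding h_def by auto
  qed
  moreover have "inj_on fst h" by (auto simp: h_def inj_on_def)
  moreover have "fst ` h = [V]\<^bsup>2\<^esup>" by (simp add: h_def image_comp comp_def)
  moreover have "has_coloured_copy H k X I" if "h \<subseteq> I" for I
    unfolding has_coloured_copy_def
  proof (intro bexI[of _ i] exI[of _ \<phi>] conjI ballI)
    show "\<phi> \<in> verts H \<rightarrow> X" using im V(1) T(2) by auto
    fix e assume e: "e \<in> edges H"
    then have "(\<phi> ` e, i) \<in> h"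
      using im2 edgesH by (auto simp: h_def intro!: image_eqI[of _ _ "\<phi> ` e"])
    then show "(\<phi> ` e, i) \<in> I" using that by blast
  next
    fix e assume e: "e \<in> [verts H]\<^bsup>2\<^esup> - edges H"
    have "\<phi> ` e \<notin> (\<lambda>d. \<phi> ` d) ` edges H"
    proof
      assume "\<phi> ` e \<in> (\<lambda>d. \<phi> ` d) ` edges H"
      then obtain d where d: "d \<in> edges H" "\<phi> ` e = \<phi> ` d" by blast
      have "d \<subseteq> verts H" "e \<subseteq> verts H" using d(1) edgesH e by (auto simp: nsets_def)
      then have "e = d" using d(2) inj by (metis inj_on_image_eq_iff)
      then show False using d(1) e by blast
    qed
    then have "(\<phi> ` e, 0) \<in> h" using im2 e by (auto simp: h_def intro!: image_eqI[of _ _ "\<phi> ` e"])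
    then show "(\<phi> ` e, 0) \<in> I" using that by blast
  qed (use i inj in auto)
  ultimately show ?thesis using V by blast
qed

text \<open>
  First moment: the expected number of pairs outside \<open>U\<close> in a random \<open>R\<close>-set is at most \<open>1 / 2\<close>.
\<close>
lemma many_cliques:
  assumes X: "finite X" "R \<le> card X" "0 < card X"
    and U: "real (card ([X]\<^bsup>2\<^esup> - U)) * (R / card X)\<^sup>2 \<le> 1 / 2"
  shows "real (card X choose R) \<le> 2 * card {T \<in> [X]\<^bsup>R\<^esup>. [T]\<^bsup>2\<^esup> \<subseteq> U}"
proof -
  let ?G = "{T \<in> [X]\<^bsup>R\<^esup>. [T]\<^bsup>2\<^esup> \<subseteq> U}" and ?D = "[X]\<^bsup>2\<^esup> - U"
  let ?B = "\<lambda>e. {T \<in> [X]\<^bsup>R\<^esup>. e \<subseteq> T}"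
  have fin: "finite ([X]\<^bsup>R\<^esup>)" "finite ?D" using X by (auto simp: finite_imp_finite_nsets)
  have "[X]\<^bsup>R\<^esup> \<subseteq> ?G \<union> (\<Union>e\<in>?D. ?B e)"
  proof
    fix T assume T: "T \<in> [X]\<^bsup>R\<^esup>"
    show "T \<in> ?G \<union> (\<Union>e\<in>?D. ?B e)"
    proof (cases "[T]\<^bsup>2\<^esup> \<subseteq> U")
      case False
      then obtain e where e: "e \<in> [T]\<^bsup>2\<^esup>" "e \<notin> U" by blast
      have "T \<subseteq> X" "e \<subseteq> T" using T e by (auto simp: nsets_def)
      then show ?thesis using T e nsets_mono[of T X 2] by auto
    qed (use T in simp)
  qed
  then have "card ([X]\<^bsup>R\<^esup>) \<le> card (?G \<union> (\<Union>e\<in>?D. ?B e))"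
    using fin by (intro card_mono) auto
  also have "\<dots> \<le> card ?G + card (\<Union>e\<in>?D. ?B e)" by (rule card_Un_le)
  also have "\<dots> \<le> card ?G + (\<Sum>e\<in>?D. card (?B e))"
    using fin by (intro add_left_mono card_UN_le) auto
  finally have "real (card X choose R) \<le> card ?G + (\<Sum>e\<in>?D. real (card (?B e)))"
    using X by (simp flip: of_nat_sum of_nat_add)
  also have "(\<Sum>e\<in>?D. real (card (?B e))) \<le> (\<Sum>e\<in>?D. (R / card X)\<^sup>2 * (card X choose R))"
  proof (rule sum_mono)
    fix e assume "e \<in> ?D"
    then have "e \<subseteq> X" "card e = 2" by (auto simp: nsets_def)
    then show "real (card (?B e)) \<le> (R / card X)\<^sup>2 * (card X choose R)"
      using card_supersets_le[of X e R] X by simp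
  qed
  also have "\<dots> = (card ?D * (R / card X)\<^sup>2) * (card X choose R)" by simp
  also have "\<dots> \<le> 1 / 2 * (card X choose R)" using U by (intro mult_right_mono) auto
  finally show ?thesis by simp
qed

text \<open>
  The sets \<open>h T\<close> and \<open>h T'\<close> share at most one type for each pair inside \<open>W = V T \<inter> V T'\<close>. Union bound
  over all \<open>W \<subseteq> V T\<close> with \<open>W \<subseteq> T'\<close>: it is the random \<open>R\<close>-set \<open>T'\<close> that is unlikely to contain \<open>W\<close>,
  no matter how \<open>V T'\<close> is chosen inside. Thus only powers of \<open>R / card X\<close> are lost, and no factor
  such as the number of \<open>n\<close>-subsets of an \<open>R\<close>-set.
\<close>
lemma copies_weakly_overlap:
  fixes V :: "'a set \<Rightarrow> 'a set" and h :: "'a set \<Rightarrow> ('a set \<times> 'c) set" and p :: real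
  assumes X: "finite X" "0 < card X" and TT: "\<T> \<subseteq> [X]\<^bsup>R\<^esup>" "T \<in> \<T>"
    and p: "0 < p" "p \<le> 1" and large: "2 * real n * R \<le> card X * p ^ (n - 1)"
    and V: "\<And>T. T \<in> \<T> \<Longrightarrow> V T \<subseteq> T \<and> card (V T) = n"
    and h: "\<And>T. T \<in> \<T> \<Longrightarrow> inj_on fst (h T) \<and> fst ` h T = [V T]\<^bsup>2\<^esup>"
  shows "(\<Sum>T'\<in>{T'\<in>\<T>. h T' \<inter> h T \<noteq> {}}. 1 / p ^ card (h T' \<inter> h T))
    \<le> 2 * (real n * R / card X)\<^sup>2 / p * (card X choose R)"
proof -
  let ?W = "{W\<in>Pow (V T). 2 \<le> card W}" and ?x = "R / card X"
  have fin: "finite \<T>" using TT X finite_subset by (metis finite_imp_finite_nsets)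
  have finT: "finite T'" if "T' \<in> \<T>" for T' using TT(1) that by (auto simp: nsets_def)
  have finV: "finite (V T')" if "T' \<in> \<T>" for T' using V[OF that] finT[OF that] finite_subset by blast
  have VT: "V T \<subseteq> T" "card (V T) = n" "T \<subseteq> X" using V TT by (auto simp: nsets_def)
  have each: "1 / p ^ card (h T' \<inter> h T) \<le> (\<Sum>W\<in>?W. of_bool (W \<subseteq> T') * (1 / p ^ (card W choose 2)))"
    if T': "T' \<in> {T'\<in>\<T>. h T' \<inter> h T \<noteq> {}}" for T'
  proof -
    let ?I = "V T' \<inter> V T"
    have T'': "T' \<in> \<T>" using T' by simp
    have "fst ` (h T' \<inter> h T) \<subseteq> [V T']\<^bsup>2\<^esup> \<inter> [V T]\<^bsup>2\<^esup>" using h[OF T''] h[OF TT(2)] by blast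
    also have "\<dots> = [?I]\<^bsup>2\<^esup>" by (auto simp: nsets_def)
    finally have sub: "fst ` (h T' \<inter> h T) \<subseteq> [?I]\<^bsup>2\<^esup>" .
    have finI: "finite ?I" using finV TT(2) by blast
    have "card (h T' \<inter> h T) = card (fst ` (h T' \<inter> h T))"
      using h[OF TT(2)] by (intro card_image[symmetric]) (auto intro: inj_on_subset)
    also have "\<dots> \<le> card ([?I]\<^bsup>2\<^esup>)"
      using sub finI by (intro card_mono) (auto simp: finite_imp_finite_nsets)
    also have "\<dots> = card ?I choose 2" by simp
    finally have "1 / p ^ card (h T' \<inter> h T) \<le> 1 / p ^ (card ?I choose 2)"
      using p by (intro divide_left_mono power_decreasing) auto
    also have "\<dots> = (\<Sum>W\<in>{?I}. of_bool (W \<subseteq> T') * (1 / p ^ (card W choose 2)))"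
      using V[OF T''] by auto
    also have "\<dots> \<le> (\<Sum>W\<in>?W. of_bool (W \<subseteq> T') * (1 / p ^ (card W choose 2)))"
    proof (rule sum_mono2)
      show "finite ?W" using finV[OF TT(2)] by simp
      have "[?I]\<^bsup>2\<^esup> \<noteq> {}" using sub T' by blast
      then have "2 \<le> card ?I" using finI by (metis nsets_eq_empty not_le_imp_less)
      then show "{?I} \<subseteq> ?W" by auto
    qed (use p in auto)
    finally show ?thesis .
  qed
  have "(\<Sum>T'\<in>{T'\<in>\<T>. h T' \<inter> h T \<noteq> {}}. 1 / p ^ card (h T' \<inter> h T))
      \<le> (\<Sum>T'\<in>{T'\<in>\<T>. h T' \<inter> h T \<noteq> {}}. \<Sum>W\<in>?W. of_bool (W \<subseteq> T') * (1 / p ^ (card W choose 2)))"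
    by (intro sum_mono each)
  also have "\<dots> \<le> (\<Sum>T'\<in>[X]\<^bsup>R\<^esup>. \<Sum>W\<in>?W. of_bool (W \<subseteq> T') * (1 / p ^ (card W choose 2)))"
    using TT X p by (intro sum_mono2 sum_nonneg) (auto simp: finite_imp_finite_nsets)
  also have "\<dots> = (\<Sum>W\<in>?W. \<Sum>T'\<in>[X]\<^bsup>R\<^esup>. of_bool (W \<subseteq> T') * (1 / p ^ (card W choose 2)))"
    by (rule sum.swap)
  also have "\<dots> = (\<Sum>W\<in>?W. card {T'\<in>[X]\<^bsup>R\<^esup>. W \<subseteq> T'} * (1 / p ^ (card W choose 2)))"
  proof (intro sum.cong refl)
    fix W
    have "(\<Sum>T'\<in>[X]\<^bsup>R\<^esup>. of_bool (W \<subseteq> T') * (1 / p ^ (card W choose 2)))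
        = (\<Sum>T'\<in>[X]\<^bsup>R\<^esup>. of_bool (W \<subseteq> T')) * (1 / p ^ (card W choose 2))"
      by (rule sum_distrib_right[symmetric])
    also have "(\<Sum>T'\<in>[X]\<^bsup>R\<^esup>. of_bool (W \<subseteq> T')) = real (card {T'\<in>[X]\<^bsup>R\<^esup>. W \<subseteq> T'})"
      using X by (simp add: finite_imp_finite_nsets Int_def of_bool_def sum.If_cases)
    finally show "(\<Sum>T'\<in>[X]\<^bsup>R\<^esup>. of_bool (W \<subseteq> T') * (1 / p ^ (card W choose 2)))
        = card {T'\<in>[X]\<^bsup>R\<^esup>. W \<subseteq> T'} * (1 / p ^ (card W choose 2))" .
  qed
  also have "\<dots> \<le> (\<Sum>W\<in>?W. (?x ^ card W * (card X choose R)) * (1 / p ^ (card W choose 2)))"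
    using X VT p by (intro sum_mono mult_right_mono card_supersets_le) auto
  also have "\<dots> = (\<Sum>W\<in>?W. ?x ^ card W / p ^ (card W choose 2)) * (card X choose R)"
    by (simp add: sum_distrib_right)
  also have "\<dots> \<le> 2 * (n * ?x)\<^sup>2 / p * (card X choose R)"
  proof (intro mult_right_mono sum_overlap_sets_le)
    show "2 * (real n * ?x) \<le> p ^ (n - 1)"
      using large X by (simp add: field_simps)
  qed (use VT p X finV TT in auto)
  finally show ?thesis by simp
qed

text \<open>
  Janson's inequality for the copies chosen inside the \<open>R\<close>-sets all of whose pairs are undecided.
  These make up at least half of all \<open>R\<close>-sets, and the copies are weighted uniformly over them.
\<close>
lemma prob_no_coloured_copy_le:
  fixes H :: "'b graph" and X :: "'a set" and p :: real
  assumes H: "simple_graph H" "card (verts H) = n" and n: "n \<ge> 2"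
    and arr: "arrows (complete_graph R) (complete_graph n) k"
    and X: "finite X" "0 < card X" "0 < R" "R \<le> card X"
    and p: "0 < p" "p \<le> 1" and large: "2 * real n * R \<le> card X * p ^ (n - 1)"
    and A: "finite A"
    and U: "real (card ([X]\<^bsup>2\<^esup> - undecided_pairs k X A)) \<le> (real (card X))\<^sup>2 / (2 * (real R)\<^sup>2)"
  shows "expect p A (\<lambda>I. of_bool (\<not> has_coloured_copy H k X (S \<union> I)))
    \<le> exp (- (p * (real (card X))\<^sup>2 / (8 * (real n)\<^sup>2 * (real R)\<^sup>2)))"
proof -
  let ?c = "card X choose R"
  define \<T> where "\<T> = {T \<in> [X]\<^bsup>R\<^esup>. [T]\<^bsup>2\<^esup> \<subseteq> undecided_pairs k X A}"
  have "real (card ([X]\<^bsup>2\<^esup> - undecided_pairs k X A)) * (R / card X)\<^sup>2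
      \<le> (real (card X))\<^sup>2 / (2 * (real R)\<^sup>2) * (R / card X)\<^sup>2"
    using U by (intro mult_right_mono) auto
  also have "\<dots> = 1 / 2"
  proof -
    have "N\<^sup>2 / (2 * r\<^sup>2) * (r / N)\<^sup>2 = 1 / 2" if "0 < N" "0 < r" for N r :: real
      using that by (simp add: field_simps)
    from this[of "card X" R] show ?thesis using X(2,3) by simp
  qed
  finally have many: "real ?c \<le> 2 * card \<T>"
    unfolding \<T>_def using X by (intro many_cliques) auto
  have c_pos: "0 < ?c" using X by simp
  have "card \<T> \<noteq> 0"
  proof
    assume "card \<T> = 0"
    with many have "real ?c \<le> 0" by simp
    then show False using c_pos by linarith
  qed
  then have T_pos: "0 < card \<T>" by simp
  then have finT: "finite \<T>" by (rule card_ge_0_finite)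
  have TX: "\<T> \<subseteq> [X]\<^bsup>R\<^esup>" by (auto simp: \<T>_def)
  have "\<forall>T\<in>\<T>. \<exists>V h. V \<subseteq> T \<and> card V = n \<and> h \<subseteq> A \<and> inj_on fst h \<and> fst ` h = [V]\<^bsup>2\<^esup>
    \<and> (\<forall>I. h \<subseteq> I \<longrightarrow> has_coloured_copy H k X I)"
    by (intro ballI coloured_copy_in_clique[OF H arr]) (auto simp: \<T>_def nsets_def)
  then obtain V h where Vh: "\<And>T. T \<in> \<T> \<Longrightarrow> V T \<subseteq> T \<and> card (V T) = n \<and> h T \<subseteq> A \<and> inj_on fst (h T)
    \<and> fst ` h T = [V T]\<^bsup>2\<^esup> \<and> (\<forall>I. h T \<subseteq> I \<longrightarrow> has_coloured_copy H k X I)"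
    by metis
  let ?w = "\<lambda>T :: 'a set. 1 / card \<T>" and ?s = "2 * (real n * R / card X)\<^sup>2 / p"
  have s_pos: "0 < ?s"
    using n X(2,3) p by (intro divide_pos_pos mult_pos_pos zero_less_power) simp_all
  have "overlap_weight p ?w h \<T>
      = (\<Sum>T\<in>\<T>. 1 / card \<T> * (1 / card \<T> * (\<Sum>T'\<in>{T'\<in>\<T>. h T' \<inter> h T \<noteq> {}}. 1 / p ^ card (h T' \<inter> h T))))"
    unfolding overlap_weight_def by (simp add: sum_divide_distrib mult.commute)
  also have "\<dots> \<le> (\<Sum>T\<in>\<T>. 1 / card \<T> * (1 / card \<T> * (?s * ?c)))"
  proof (intro sum_mono mult_left_mono)
    fix T assume "T \<in> \<T>"
    then show "(\<Sum>T'\<in>{T'\<in>\<T>. h T' \<inter> h T \<noteq> {}}. 1 / p ^ card (h T' \<inter> h T)) \<le> ?s * ?c"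
      using Vh by (intro copies_weakly_overlap[OF X(1,2) TX _ p large]) auto
  qed auto
  also have "\<dots> = ?s * (?c / card \<T>)" using T_pos by simp
  also have "\<dots> \<le> ?s * 2"
    using many T_pos s_pos by (intro mult_left_mono) (auto simp: field_simps)
  finally have overlap: "overlap_weight p ?w h \<T> \<le> ?s * 2" .
  have "expect p A (\<lambda>I. of_bool (\<not> has_coloured_copy H k X (S \<union> I)))
      \<le> expect p A (\<lambda>I. of_bool (\<forall>T\<in>\<T>. \<not> h T \<subseteq> I))"
  proof (rule expect_mono)
    fix I
    have "has_coloured_copy H k X (S \<union> I)" if "T \<in> \<T>" "h T \<subseteq> I" for T
      using Vh[OF that(1)] that(2) by (simp add: le_supI2)
    then show "of_bool (\<not> has_coloured_copy H k X (S \<union> I)) \<le> (of_bool (\<forall>T\<in>\<T>. \<not> h T \<subseteq> I) :: real)"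
      by (auto simp: of_bool_def)
  qed (use p in auto)
  also have "\<dots> \<le> exp (- 1 / (2 * (?s * 2)))"
    using finT A Vh p T_pos overlap s_pos by (intro janson[of _ _ _ _ ?w]) auto
  also have "- 1 / (2 * (?s * 2)) = - (p * (real (card X))\<^sup>2 / (8 * (real n)\<^sup>2 * (real R)\<^sup>2))"
    using p by (simp add: power_divide power_mult_distrib mult_ac)
  finally show ?thesis by simp
qed

section \<open>Counting the graphs with a bad colouring\<close>

definition colouring_types :: "'a set \<Rightarrow> 'a set set \<Rightarrow> ('a set \<Rightarrow> nat) \<Rightarrow> ('a set \<times> nat) set" where
  "colouring_types X G c = (\<lambda>e. (e, if e \<in> G then c e else 0)) ` [X]\<^bsup>2\<^esup>"

lemma colouring_types_iff:
  "(e, i) \<in> colouring_types X G c \<longleftrightarrow> e \<in> [X]\<^bsup>2\<^esup> \<and> i = (if e \<in> G then c e else 0)"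
  by (simp add: colouring_types_def image_iff)

lemma not_induced_arrows_colouring:
  assumes "\<not> induced_arrows (Graph X G) H k" "G \<subseteq> [X]\<^bsup>2\<^esup>" "simple_graph H"
  obtains c where "c \<in> G \<rightarrow> {1..k}" "\<not> has_coloured_copy H k X (colouring_types X G c)"
proof -
  obtain c where c: "c \<in> G \<rightarrow> {1..k}" and none: "\<forall>i\<in>{1..k}. \<not> (\<exists>\<phi>. inj_on \<phi> (verts H) \<and>
      \<phi> \<in> verts H \<rightarrow> X \<and> (\<lambda>e. \<phi> ` e) ` edges H \<subseteq> {e \<in> G. c e = i} \<and>
      (\<lambda>e. \<phi> ` e) ` ([verts H]\<^bsup>2\<^esup> - edges H) \<inter> G = {})"
    using assms(1) unfolding induced_arrows_def colour_class_def graph.sel ball_simps bex_simps by (elim bexE)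
  have "\<not> has_coloured_copy H k X (colouring_types X G c)"
  proof
    assume "has_coloured_copy H k X (colouring_types X G c)"
    then obtain i \<phi> where i: "i \<in> {1..k}" and \<phi>: "inj_on \<phi> (verts H)" "\<phi> \<in> verts H \<rightarrow> X"
      and yes: "\<And>e. e \<in> edges H \<Longrightarrow> (\<phi> ` e, i) \<in> colouring_types X G c"
      and no: "\<And>e. e \<in> [verts H]\<^bsup>2\<^esup> - edges H \<Longrightarrow> (\<phi> ` e, 0) \<in> colouring_types X G c"
      unfolding has_coloured_copy_def by blast
    have yes_sub: "(\<lambda>e. \<phi> ` e) ` edges H \<subseteq> {e \<in> G. c e = i}"
    proof (clarify, intro conjI)
      fix e assume "e \<in> edges H"
      then have "i = (if \<phi> ` e \<in> G then c (\<phi> ` e) else 0)" using yes colouring_types_iff by blast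
      then show "\<phi> ` e \<in> G" "c (\<phi> ` e) = i" using i by (auto split: if_splits)
    qed
    have "\<phi> ` e \<notin> G" if "e \<in> [verts H]\<^bsup>2\<^esup> - edges H" for e
    proof
      assume "\<phi> ` e \<in> G"
      then have "c (\<phi> ` e) = 0" using no[OF that] by (simp add: colouring_types_iff)
      then show False using c \<open>\<phi> ` e \<in> G\<close> by force
    qed
    then have "(\<lambda>e. \<phi> ` e) ` ([verts H]\<^bsup>2\<^esup> - edges H) \<inter> G = {}" by auto
    with yes_sub \<phi> have "\<exists>\<phi>. inj_on \<phi> (verts H) \<and>
      \<phi> \<in> verts H \<rightarrow> X \<and> (\<lambda>e. \<phi> ` e) ` edges H \<subseteq> {e \<in> G. c e = i} \<and>
      (\<lambda>e. \<phi> ` e) ` ([verts H]\<^bsup>2\<^esup> - edges H) \<inter> G = {}"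
      by (intro exI[of _ \<phi>] conjI)
    with bspec[OF none i] show False by (rule notE)
  qed
  with c show ?thesis by (rule that)
qed

text \<open>
  If two graphs in the same container differ in \<open>e\<close>, then \<open>e\<close> has type 0 in one encoding and a colour
  in the other. Neither type can lie in \<open>S\<close>, which both encodings contain, so both lie in \<open>A\<close>.
\<close>
lemma card_graphs_in_container:
  assumes X: "finite X" and c: "\<And>G. G \<in> \<G> \<Longrightarrow> c G \<in> G \<rightarrow> {1..k}"
    and G: "\<G> \<subseteq> Pow ([X]\<^bsup>2\<^esup>)"
    and compat: "\<And>G. G \<in> \<G> \<Longrightarrow> S \<subseteq> colouring_types X G (c G) \<and> colouring_types X G (c G) \<subseteq> S \<union> A"
  shows "card \<G> \<le> 2 ^ card (undecided_pairs k X A)"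
proof -
  let ?U = "undecided_pairs k X A"
  have finU: "finite ?U"
    using X finite_subset[of ?U "[X]\<^bsup>2\<^esup>"] by (auto simp: undecided_pairs_def finite_imp_finite_nsets)
  have differ: "e \<in> ?U" if "G \<in> \<G>" "G' \<in> \<G>" "e \<in> G" "e \<notin> G'" for G G' e
  proof -
    have e: "e \<in> [X]\<^bsup>2\<^esup>" using that G by blast
    have ce: "c G e \<in> {1..k}" using c[OF that(1)] that(3) by auto
    have "(e, c G e) \<in> colouring_types X G (c G)" "(e, 0) \<in> colouring_types X G' (c G')"
      "(e, c G e) \<notin> colouring_types X G' (c G')" "(e, 0) \<notin> colouring_types X G (c G)"
      using e ce that by (auto simp: colouring_types_iff)
    then have "(e, c G e) \<in> A" "(e, 0) \<in> A"
      using compat[OF that(1)] compat[OF that(2)] by blast+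
    then show ?thesis using e ce by (auto simp: undecided_pairs_def)
  qed
  have "inj_on (\<lambda>G. G \<inter> ?U) \<G>"
    by (rule inj_onI) (use differ in blast)
  then have "card \<G> = card ((\<lambda>G. G \<inter> ?U) ` \<G>)" by (simp add: card_image)
  also have "\<dots> \<le> card (Pow ?U)" using finU by (intro card_mono) auto
  finally show ?thesis using finU by (simp add: card_Pow)
qed

lemma half_le_ln_2: "(1 / 2 :: real) \<le> ln 2"
  using exp_bound_half[of "1 / 2 :: real"] by (subst ln_ge_iff) auto

text \<open>
  Suppose that every graph on \<open>N = D ^ (7 * n)\<close> vertices has a bad colouring. The containers of the
  encodings cover all \<open>2 ^ (N choose 2)\<close> graphs, and each of them covers at most
  \<open>2 ^ card (undecided_pairs k X A)\<close> graphs. By \<open>prob_no_coloured_copy_le\<close> every container decides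
  more than \<open>N\<^sup>2 / (2 * R\<^sup>2)\<close> pairs, and this beats the number of containers.

  The parameters are forced in the following order. Janson's inequality yields a contradiction for
  \<open>\<delta>\<close> of order \<open>1 / (n\<^sup>2 * R\<^sup>2 * k)\<close>. To count containers, \<open>(1 - \<delta>) ^ \<theta>\<close> and \<open>\<theta> * p\<close> have to be
  below \<open>1 / (8 * k * R\<^sup>2)\<close>, so that \<open>\<theta> = 8 * k * R\<^sup>2 / \<delta>\<close> and a \<open>p\<close> of order
  \<open>1 / (k ^ 3 * n\<^sup>2 * R ^ 6)\<close> suffice; \<open>p = 1 / D ^ 7\<close> is below that. Finally \<open>N * p ^ (n - 1) = D ^ 7\<close>
  is large enough for \<open>sum_overlap_sets_le\<close>.
\<close>
lemma induced_ramsey_host_bound: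
  fixes H :: "nat graph"
  assumes H: "simple_graph H" "card (verts H) = n" and n: "n \<ge> 2" and k: "k \<ge> 1"
    and R: "n \<le> R" and arr: "arrows (complete_graph R) (complete_graph n) k"
    and D: "4 * n\<^sup>2 * k * R \<le> D"
  shows "induced_ramsey_host H k (D ^ (7 * n))"
proof (rule ccontr)
  assume not_host: "\<not> ?thesis"
  define N where "N = D ^ (7 * n)"
  define X where "X = {..<N}"
  define p :: real where "p = 1 / real D ^ 7"
  define \<delta> :: real where "\<delta> = 1 / (32 * (real n)\<^sup>2 * (real R)\<^sup>2 * real k)"
  define \<theta> where "\<theta> = 256 * k\<^sup>2 * n\<^sup>2 * R ^ 4"
  define A0 where "A0 = [X]\<^bsup>2\<^esup> \<times> {0..k}"
  define F where "F = (\<lambda>I. \<not> has_coloured_copy H k X I)"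
  have pos: "1 \<le> real n" "1 \<le> real k" "1 \<le> real R" using n k R by auto
  have X: "finite X" "card X = N" by (auto simp: X_def)
  have "4 * 1 * 1 * 1 \<le> 4 * n\<^sup>2 * k * R" using n k R by (intro mult_le_mono) auto
  then have D4: "4 \<le> D" using D by linarith
  have N_pos: "0 < N" using D4 by (simp add: N_def)
  have p_pos: "0 < p" using D4 by (simp add: p_def)
  have "D ^ 7 \<ge> D ^ 1" using D4 by (intro power_increasing) auto
  then have D7: "D \<le> D ^ 7" by simp
  have "2 \<le> real (D ^ 7)" using D4 D7 by linarith
  then have p_half: "p \<le> 1 / 2" by (simp add: p_def divide_simps)
  have nR: "2 * n * R \<le> D"
  proof -
    have "2 * n * R * 1 \<le> 2 * n * R * (2 * n * k)" using n k by (intro mult_left_mono) auto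
    also have "\<dots> = 4 * n\<^sup>2 * k * R" by (simp add: power2_eq_square)
    finally show ?thesis using D by linarith
  qed
  have large: "2 * real n * R \<le> N * p ^ (n - 1)"
  proof -
    have "N = D ^ 7 * D ^ (7 * (n - 1))"
      using n by (simp add: N_def flip: power_add) (simp add: algebra_simps)
    then have "N * p ^ (n - 1) = real D ^ 7"
      using D4 by (simp add: p_def power_mult power_one_over)
    moreover have "real (2 * n * R) \<le> real (D ^ 7)" using nR D7 by linarith
    ultimately show ?thesis by simp
  qed
  have R_le_N: "R \<le> N"
  proof -
    have "R \<le> 2 * n * R" using n by simp
    also have "\<dots> \<le> D ^ 1" using nR by simp
    also have "\<dots> \<le> D ^ (7 * n)" using D4 n by (intro power_increasing) auto
    finally show ?thesis by (simp add: N_def)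
  qed
  have ln_p: "- 2 * p \<le> ln (1 - p)"
  proof -
    have "p * p \<le> p * (1 / 2)" using p_pos p_half by (intro mult_left_mono) auto
    then show ?thesis
      using ln_one_minus_pos_lower_bound[of p] p_pos p_half unfolding power2_eq_square by linarith
  qed
  have pairs: "card ([X]\<^bsup>2\<^esup>) = N choose 2" using X by simp
  have card_A0: "real (card A0) \<le> k * (real N)\<^sup>2"
  proof -
    have "card A0 = (N choose 2) * (k + 1)" by (simp add: A0_def X(2) card_cartesian_product)
    also have "\<dots> \<le> (N choose 2) * (2 * k)" using k by (intro mult_left_mono) auto
    also have "\<dots> = k * (2 * (N choose 2))" by simp
    also have "\<dots> \<le> k * N\<^sup>2"
      by (intro mult_left_mono) (auto simp: choose_two power2_eq_square algebra_simps)
    finally show ?thesis by (metis of_nat_le_iff of_nat_mult of_nat_power)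
  qed
  have \<delta>: "0 < \<delta>" "\<delta> \<le> 1"
  proof -
    have "1 * 1 * 1 * 1 \<le> 32 * (real n)\<^sup>2 * (real R)\<^sup>2 * real k"
      using pos by (intro mult_mono one_le_power) auto
    then have "1 \<le> 32 * (real n)\<^sup>2 * (real R)\<^sup>2 * real k" by simp
    then show "0 < \<delta>" "\<delta> \<le> 1"
      unfolding \<delta>_def
      using divide_le_eq_1_pos[of "32 * (real n)\<^sup>2 * (real R)\<^sup>2 * real k" 1]
      by (simp_all only: zero_less_divide_1_iff)
  qed
  have down: "down_closed F"
    unfolding down_closed_def F_def using has_coloured_copy_mono by blast
  obtain \<C> where C: "finite \<C>"
    and card_C: "card \<C> \<le> exp (card A0 * ((1 - \<delta>) ^ \<theta> - \<theta> * ln (1 - p)))"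
    and cover: "\<And>I. F I \<Longrightarrow> I \<subseteq> A0 \<Longrightarrow> \<exists>(S, A)\<in>\<C>. S \<subseteq> I \<and> I \<subseteq> S \<union> A"
    and sparse: "\<And>S A. (S, A) \<in> \<C> \<Longrightarrow> A \<subseteq> A0 \<and>
      exp (ln (1 - p) * \<delta> * card A) \<le> expect p A (\<lambda>I. of_bool (F (S \<union> I)))"
    using container_lemma[of A0 p \<delta> F \<theta>] X p_pos p_half \<delta>(2) down
    by (auto simp: A0_def finite_imp_finite_nsets)
  have decided: "(real N)\<^sup>2 / (2 * (real R)\<^sup>2) < real (card ([X]\<^bsup>2\<^esup> - undecided_pairs k X A))" if SA: "(S, A) \<in> \<C>" for S A
  proof (rule ccontr)
    assume "\<not> ?thesis"
    moreover have "A \<subseteq> A0" using sparse[OF SA] by blast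
    moreover have finA0: "finite A0" using X by (simp add: A0_def finite_imp_finite_nsets)
    ultimately have "expect p A (\<lambda>I. of_bool (F (S \<union> I))) \<le> exp (- (p * (real N)\<^sup>2 / (8 * (real n)\<^sup>2 * (real R)\<^sup>2)))"
      using X N_pos R R_le_N p_pos p_half large n
      unfolding F_def X(2)[symmetric]
      by (intro prob_no_coloured_copy_le[OF H n arr]) (auto dest: finite_subset)
    moreover have "exp (ln (1 - p) * \<delta> * card A) \<le> expect p A (\<lambda>I. of_bool (F (S \<union> I)))"
      using sparse[OF SA] by blast
    ultimately have "exp (ln (1 - p) * \<delta> * card A) \<le> exp (- (p * (real N)\<^sup>2 / (8 * (real n)\<^sup>2 * (real R)\<^sup>2)))"
      by linarith
    \<comment> \<open>The constant 32 in \<open>\<delta>\<close> makes this exponent twice the one that a container allows.\<close>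
    then have le: "p * (real N)\<^sup>2 / (8 * (real n)\<^sup>2 * (real R)\<^sup>2) \<le> - (ln (1 - p) * \<delta> * card A)" by simp
    have "real (card A) \<le> k * (real N)\<^sup>2"
      using card_mono[OF finA0 \<open>A \<subseteq> A0\<close>] card_A0 by linarith
    then have "- ln (1 - p) * \<delta> * card A \<le> 2 * p * \<delta> * (k * (real N)\<^sup>2)"
      using ln_p \<delta> p_pos by (intro mult_mono mult_nonneg_nonneg) auto
    also have "\<dots> = p * (real N)\<^sup>2 / (16 * (real n)\<^sup>2 * (real R)\<^sup>2)"
      using pos by (simp add: \<delta>_def field_simps)
    also have "\<dots> < p * (real N)\<^sup>2 / (8 * (real n)\<^sup>2 * (real R)\<^sup>2)"
      using pos p_pos N_pos by (simp add: divide_simps)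
    finally show False using le by simp
  qed
  have "\<exists>c. c \<in> G \<rightarrow> {1..k} \<and> F (colouring_types X G c)" if G: "G \<in> Pow ([X]\<^bsup>2\<^esup>)" for G
  proof -
    have no: "\<not> induced_arrows (Graph X G) H k"
      using not_host G X(1) unfolding induced_ramsey_host_def N_def[symmetric]
      by (auto simp: simple_graph_def subgraph_def complete_graph_def X_def)
    have "G \<subseteq> [X]\<^bsup>2\<^esup>" using G by simp
    from not_induced_arrows_colouring[OF no this H(1)] show ?thesis
      unfolding F_def by metis
  qed
  then obtain c where c: "\<And>G. G \<in> Pow ([X]\<^bsup>2\<^esup>) \<Longrightarrow> c G \<in> G \<rightarrow> {1..k} \<and> F (colouring_types X G (c G))"
    by metis
  define compat where "compat = (\<lambda>(S, A). {G \<in> Pow ([X]\<^bsup>2\<^esup>).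
    S \<subseteq> colouring_types X G (c G) \<and> colouring_types X G (c G) \<subseteq> S \<union> A})"
  define M where "M = (N choose 2)"
  have finP: "finite (Pow ([X]\<^bsup>2\<^esup>))" using X by (simp add: finite_imp_finite_nsets)
  have "Pow ([X]\<^bsup>2\<^esup>) \<subseteq> (\<Union>SA\<in>\<C>. compat SA)"
  proof
    fix G assume G: "G \<in> Pow ([X]\<^bsup>2\<^esup>)"
    then have "c G \<in> G \<rightarrow> {1..k}" using c by blast
    then have "colouring_types X G (c G) \<subseteq> A0"
      by (force simp: colouring_types_def A0_def)
    then obtain S A where "(S, A) \<in> \<C>" "S \<subseteq> colouring_types X G (c G)" "colouring_types X G (c G) \<subseteq> S \<union> A"
      using cover c[OF G] by blast
    then show "G \<in> (\<Union>SA\<in>\<C>. compat SA)" using G by (auto simp: compat_def)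
  qed
  then have "card (Pow ([X]\<^bsup>2\<^esup>)) \<le> card (\<Union>SA\<in>\<C>. compat SA)"
    using C finP by (intro card_mono) (auto simp: compat_def)
  also have "\<dots> \<le> (\<Sum>SA\<in>\<C>. card (compat SA))" by (rule card_UN_le[OF C])
  finally have "(2::real) ^ M \<le> (\<Sum>SA\<in>\<C>. real (card (compat SA)))"
    using finP pairs by (simp add: card_Pow M_def X flip: of_nat_sum)
  also have "\<dots> \<le> (\<Sum>SA\<in>\<C>. 2 ^ M / exp ((real N)\<^sup>2 / (4 * (real R)\<^sup>2)))"
  proof (rule sum_mono)
    fix SA assume SA: "SA \<in> \<C>"
    obtain S A where SA_eq: "SA = (S, A)" by (cases SA)
    let ?U = "undecided_pairs k X A"
    have "card (compat SA) \<le> 2 ^ card ?U"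
      unfolding SA_eq compat_def using X c by (intro card_graphs_in_container[of X _ c k S A]) auto
    then have few: "real (card (compat SA)) \<le> 2 ^ card ?U"
      by (metis of_nat_le_iff of_nat_numeral of_nat_power)
    have decided_gain: "2 ^ card ?U * exp ((real N)\<^sup>2 / (4 * (real R)\<^sup>2)) \<le> (2::real) ^ M"
    proof -
      have U_sub: "?U \<subseteq> [X]\<^bsup>2\<^esup>" by (auto simp: undecided_pairs_def)
      define d where "d = card ([X]\<^bsup>2\<^esup> - ?U)"
      have Md: "M = card ?U + d"
        using card_Un_disjoint[of ?U "[X]\<^bsup>2\<^esup> - ?U"] U_sub pairs finite_subset[OF U_sub] X
        by (simp add: d_def M_def finite_imp_finite_nsets Un_absorb1)
      have "exp ((real N)\<^sup>2 / (4 * (real R)\<^sup>2)) \<le> exp (d * ln 2)"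
      proof -
        have "(real N)\<^sup>2 / (4 * (real R)\<^sup>2) \<le> d * (1 / 2)"
          using decided[of S A] SA unfolding SA_eq d_def by (simp add: field_simps)
        also have "\<dots> \<le> d * ln 2"
          using half_le_ln_2 by (intro mult_left_mono) auto
        finally show ?thesis by simp
      qed
      also have "exp (d * ln 2) = (2::real) ^ d" by (simp add: exp_of_nat_mult)
      finally show ?thesis by (simp add: Md power_add)
    qed
    have "real (card (compat SA)) * exp ((real N)\<^sup>2 / (4 * (real R)\<^sup>2)) \<le> 2 ^ M"
      by (rule order_trans[OF mult_right_mono[OF few exp_ge_zero] decided_gain])
    then show "real (card (compat SA)) \<le> 2 ^ M / exp ((real N)\<^sup>2 / (4 * (real R)\<^sup>2))"
      by (subst pos_le_divide_eq) auto
  qed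
  finally have "2 ^ M \<le> card \<C> * (2 ^ M / exp ((real N)\<^sup>2 / (4 * (real R)\<^sup>2)))" by simp
  then have "exp ((real N)\<^sup>2 / (4 * (real R)\<^sup>2)) \<le> card \<C>" by (simp add: field_simps)
  with card_C have "exp ((real N)\<^sup>2 / (4 * (real R)\<^sup>2)) \<le> exp (card A0 * ((1 - \<delta>) ^ \<theta> - \<theta> * ln (1 - p)))"
    by linarith
  then have contra: "(real N)\<^sup>2 / (4 * (real R)\<^sup>2) \<le> card A0 * ((1 - \<delta>) ^ \<theta> - \<theta> * ln (1 - p))" by simp
  have y: "(1 - \<delta>) ^ \<theta> < 1 / (8 * real k * (real R)\<^sup>2)"
  proof -
    have "(1 - \<delta>) ^ \<theta> \<le> exp (- \<delta>) ^ \<theta>"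
      using \<delta> exp_ge_add_one_self[of "- \<delta>"] by (intro power_mono) auto
    also have "\<dots> = exp (- (8 * real k * (real R)\<^sup>2))"
    proof -
      have "\<theta> * \<delta> = 8 * real k * (real R)\<^sup>2"
        using pos by (simp add: \<theta>_def \<delta>_def field_simps power2_eq_square power4_eq_xxxx)
      then show ?thesis by (simp flip: exp_of_nat_mult)
    qed
    also have "\<dots> < 1 / (8 * real k * (real R)\<^sup>2)"
    proof -
      have "0 < 8 * real k * (real R)\<^sup>2" using pos by simp
      moreover have "8 * real k * (real R)\<^sup>2 < exp (8 * real k * (real R)\<^sup>2)"
        using exp_ge_add_one_self[of "8 * real k * (real R)\<^sup>2"] by linarith
      ultimately show ?thesis by (simp add: exp_minus inverse_eq_divide frac_less2)
    qed
    finally show ?thesis .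
  qed
  have \<theta>: "\<theta> * (2 * p) \<le> 1 / (8 * real k * (real R)\<^sup>2)"
  proof -
    have "4096 * k ^ 3 * n\<^sup>2 * R ^ 6 \<le> 4 ^ 7 * k ^ 7 * n ^ 14 * R ^ 7"
      using n k R by (intro mult_le_mono power_increasing) auto
    also have "\<dots> = (4 * n\<^sup>2 * k * R) ^ 7"
      by (simp add: power_mult_distrib flip: power_mult)
    also have "\<dots> \<le> D ^ 7" using D by (intro power_mono) auto
    finally have "real (4096 * k ^ 3 * n\<^sup>2 * R ^ 6) \<le> real (D ^ 7)" by (simp only: of_nat_le_iff)
    moreover have "(8 * real k * (real R)\<^sup>2) * (\<theta> * 2) = real (4096 * k ^ 3 * n\<^sup>2 * R ^ 6)"
    proof -
      have "k ^ 3 = k * k\<^sup>2" "R ^ 6 = R\<^sup>2 * R ^ 4" by (simp_all flip: power_Suc power_add)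
      then show ?thesis by (simp add: \<theta>_def mult_ac)
    qed
    ultimately have "(8 * real k * (real R)\<^sup>2) * (\<theta> * 2) \<le> real D ^ 7"
      by (simp only: of_nat_power)
    then show ?thesis
      using pos D4 by (simp add: p_def divide_simps mult.commute)
  qed
  have y_nonneg: "0 \<le> (1 - \<delta>) ^ \<theta>" using \<delta> by simp
  have "\<theta> * - ln (1 - p) \<le> \<theta> * (2 * p)" using ln_p by (intro mult_left_mono) auto
  then have sum: "(1 - \<delta>) ^ \<theta> - \<theta> * ln (1 - p) \<le> (1 - \<delta>) ^ \<theta> + \<theta> * (2 * p)" by simp
  have "card A0 * ((1 - \<delta>) ^ \<theta> - \<theta> * ln (1 - p)) \<le> (k * (real N)\<^sup>2) * ((1 - \<delta>) ^ \<theta> + \<theta> * (2 * p))"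
    using card_A0 sum y_nonneg p_pos by (intro order_trans[OF mult_left_mono[OF sum] mult_right_mono]) auto
  also have "\<dots> < (k * (real N)\<^sup>2) * (2 * (1 / (8 * real k * (real R)\<^sup>2)))"
    using y \<theta> k N_pos by (intro mult_strict_left_mono) auto
  also have "\<dots> = (real N)\<^sup>2 / (4 * (real R)\<^sup>2)" using pos by (simp add: field_simps)
  finally show False using contra by simp
qed

section \<open>The bound\<close>

text \<open>
  A graph on at most one vertex has no pairs, so the edgeless graph of its size is a host.
\<close>
lemma trivial_host:
  fixes H :: "nat graph"
  assumes H: "simple_graph H" "card (verts H) = n" and "n \<le> 1" "k \<ge> 1" "n \<le> N"
  shows "induced_ramsey_host H k N"
proof -
  have none: "[Y]\<^bsup>2\<^esup> = {}" if "finite Y" "card Y \<le> 1" for Y :: "nat set"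
    using that by (simp add: nsets_eq_empty)
  have fin: "finite (verts H)" and "edges H \<subseteq> [verts H]\<^bsup>2\<^esup>" using H(1) by (auto simp: simple_graph_def)
  then have noH: "[verts H]\<^bsup>2\<^esup> = {}" "edges H = {}" using none[OF fin] H(2) assms(3) by auto
  obtain \<phi> where "bij_betw \<phi> (verts H) {..<n}"
    using fin H(2) by (metis card_lessThan finite_lessThan finite_same_card_bij)
  then have \<phi>: "inj_on \<phi> (verts H)" "\<phi> \<in> verts H \<rightarrow> {..<n}" by (auto simp: bij_betw_def)
  have "induced_arrows (Graph {..<n} {}) H k"
    unfolding induced_arrows_def
    using \<phi> assms(4) noH by (intro ballI bexI[of _ 1] exI[of _ \<phi>]) auto
  then show ?thesis
    unfolding induced_ramsey_host_def using assms(5)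
    by (intro exI[of _ "Graph {..<n} {}"]) (auto simp: simple_graph_def subgraph_def complete_graph_def)
qed

text \<open>
  The factor \<open>R\<close> dominates: its logarithm is at most \<open>s = k * n * ln k\<close> by \<open>ramsey_number_le\<close>, and all
  other logarithms are bounded by multiples of \<open>s\<close> too.
\<close>
lemma power_bound_le_exp:
  assumes "k \<ge> 2" "n \<ge> 1"
  shows "(100 * real n ^ 2 * real k * real (ramsey_number n k)) ^ (7 * n)
    \<le> exp (100 * real k * real n ^ 2 * ln (real k))"
proof -
  define R where "R = ramsey_number n k"
  define s where "s = real k * real n * ln (real k)"
  have R_pos: "1 \<le> R" using ramsey_number_ge[of k n] assms by (simp add: R_def)
  have k_ln: "1 \<le> real k * ln (real k)"
  proof -
    have "1 \<le> 2 * ln (2::real)" using half_le_ln_2 by simp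
    also have "\<dots> \<le> real k * ln (real k)" using assms half_le_ln_2 by (intro mult_mono) auto
    finally show ?thesis .
  qed
  have ln_k: "0 \<le> ln (real k)" using assms by simp
  have n_s: "real n \<le> s"
    using mult_left_mono[OF k_ln, of "real n"] by (simp add: s_def mult_ac)
  have ln_n: "ln (real n) \<le> s"
    using ln_le_minus_one[of "real n"] n_s assms by simp
  have ln_k_s: "ln (real k) \<le> s"
  proof -
    have "1 * ln (real k) \<le> (real k * real n) * ln (real k)"
    proof (intro mult_right_mono ln_k)
      have "1 * 1 \<le> real k * real n" using assms by (intro mult_mono) auto
      then show "1 \<le> real k * real n" by simp
    qed
    then show ?thesis by (simp add: s_def)
  qed
  have ln_R: "ln (real R) \<le> s"
  proof -
    have "real R \<le> real k ^ (k * n)"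
      using ramsey_number_le[of k n] assms by (simp add: R_def flip: of_nat_power)
    then have "ln (real R) \<le> ln (real k ^ (k * n))" using R_pos assms by (intro ln_mono) auto
    also have "\<dots> = s" using assms by (simp add: s_def ln_realpow)
    finally show ?thesis .
  qed
  have ln_100: "ln 100 \<le> 9 * s"
  proof -
    have "ln (100::real) \<le> ln (2 ^ 9)" by simp
    also have "\<dots> = 9 * ln 2" by (subst ln_realpow) auto
    also have "\<dots> \<le> 9" using ln_le_minus_one[of "2::real"] by simp
    finally have "ln (100::real) \<le> 9" .
    moreover have "1 \<le> s" using n_s assms by simp
    ultimately show ?thesis by simp
  qed
  have "ln ((100 * real n ^ 2 * real k * real R) ^ (7 * n))
      = 7 * real n * (ln 100 + 2 * ln (real n) + ln (real k) + ln (real R))"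
    using assms R_pos by (simp add: ln_realpow ln_mult)
  also have "\<dots> \<le> 7 * real n * (13 * s)"
    using ln_100 ln_n ln_k_s ln_R by (intro mult_left_mono) auto
  also have "\<dots> = 91 * (real n * s)" by simp
  also have "\<dots> \<le> 100 * (real n * s)" using n_s by (intro mult_right_mono) auto
  also have "\<dots> = 100 * real k * real n ^ 2 * ln (real k)" by (simp add: s_def power2_eq_square)
  finally have le: "ln ((100 * real n ^ 2 * real k * real R) ^ (7 * n)) \<le> 100 * real k * real n ^ 2 * ln (real k)" .
  have pos: "0 < (100 * real n ^ 2 * real k * real R) ^ (7 * n)" using assms R_pos by simp
  show ?thesis
    using le pos unfolding R_def[symmetric] by (metis exp_le_cancel_iff exp_ln)
qed

theorem theorem1p5:
  shows "\<exists>C::real. \<forall>(k::nat) (n::nat) (H::nat graph).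
    k \<ge> 1 \<and> simple_graph H \<and> card (verts H) = n \<longrightarrow>
      (\<exists>N. induced_ramsey_host H k N) \<and>
      real (induced_ramsey_number H k)
        \<le> (C * real n ^ 2 * real k * real (ramsey_number n k)) ^ (7 * n) \<and>
      (k \<ge> 2 \<longrightarrow>
        (C * real n ^ 2 * real k * real (ramsey_number n k)) ^ (7 * n)
          \<le> exp (C * real k * real n ^ 2 * ln (real k)))"
proof (intro exI[of _ 100] allI impI)
  fix k n :: nat and H :: "nat graph"
  assume "k \<ge> 1 \<and> simple_graph H \<and> card (verts H) = n"
  then have k: "k \<ge> 1" and H: "simple_graph H" "card (verts H) = n" by auto
  define R where "R = ramsey_number n k"
  define D where "D = 100 * n\<^sup>2 * k * R"
  have R: "n \<le> R" using ramsey_number_ge[OF k] by (simp add: R_def)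
  have host: "induced_ramsey_host H k (D ^ (7 * n))"
  proof (cases "n \<le> 1")
    case True
    have "n \<le> D ^ (7 * n)"
    proof (cases "n = 0")
      case False
      then have "n = 1" "1 \<le> D" using True R k by (auto simp: D_def)
      then show ?thesis by simp
    qed simp
    then show ?thesis using trivial_host[OF H True k] by blast
  next
    case False
    have "arrows (complete_graph R) (complete_graph n) k"
      using ramsey_number_arrows[OF k] by (simp add: R_def)
    then show ?thesis
      using False R k H by (intro induced_ramsey_host_bound) (auto simp: D_def)
  qed
  then have "induced_ramsey_number H k \<le> D ^ (7 * n)"
    unfolding induced_ramsey_number_def by (rule Least_le)
  then have "real (induced_ramsey_number H k) \<le> real (D ^ (7 * n))"
    by (simp only: of_nat_le_iff)
  also have "real (D ^ (7 * n)) = (100 * real n ^ 2 * real k * real R) ^ (7 * n)"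
    by (simp add: D_def)
  finally have "real (induced_ramsey_number H k) \<le> (100 * real n ^ 2 * real k * real R) ^ (7 * n)" .
  moreover have "(100 * real n ^ 2 * real k * real R) ^ (7 * n)
      \<le> exp (100 * real k * real n ^ 2 * ln (real k))" if "k \<ge> 2"
    using power_bound_le_exp[OF that] unfolding R_def by (cases "n = 0") auto
  ultimately show "(\<exists>N. induced_ramsey_host H k N) \<and>
      real (induced_ramsey_number H k)
        \<le> (100 * real n ^ 2 * real k * real (ramsey_number n k)) ^ (7 * n) \<and>
      (k \<ge> 2 \<longrightarrow>
        (100 * real n ^ 2 * real k * real (ramsey_number n k)) ^ (7 * n)
          \<le> exp (100 * real k * real n ^ 2 * ln (real k)))"
    using host unfolding R_def by blast
qed

end
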